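(* Let $\mu$ be a positive Borel measure on $[0,1)$ with $\int_{[0,1)}\log\frac{2}{1-t}\,d\mu(t)<\infty$. Then the following two conditions are equivalent: (i) The measure $\nu$ on $[0,1)$ defined by $d\nu(t)=\log\frac{2}{1-t}\,d\mu(t)$ is a Carleson measure. (ii) For any given $s\in(0,\infty)$, the operator $I_\mu$ is bounded from $Q_s$ into $BMOA$.
   Context: $\mathbb D=\{z\in\mathbb C:|z|<1\}$, and $dA(z)=\frac{dx\,dy}{\pi}$ is the normalized area measure on $\mathbb D$. For $0\le s<\infty$, $Q_s$ is the set of analytic functions $f$ in $\mathbb D$ with $\|f\|_{Q_s}=\left(|f(0)|^2+\rho_{Q_s}(f)^2\right)^{1/2}<\infty$, where $\rho_{Q_s}(f)=\left(\sup_{a\in\mathbb D}\int_{\mathbb D}|f'(z)|^2g(z,a)^s\,dA(z)\right)^{1/2}$ and $g(z,a)=\log\left|\frac{1-\overline a z}{z-a}\right|$. For $a\in\mathbb D$ let $\varphi_a(z)=\frac{a-z}{1-\overline a z}$; $BMOA$ is the set of analytic functions $f$ in $\mathbb D$ with $\|f\|_{BMOA}=|f(0)|+\sup_{a\in\mathbb D}\|f\circ\varphi_a-f(a)\|_{H^2}<\infty$, where $H^2$ is the Hardy space. The operator $I_\mu$ is given by $I_\mu(f)(z)=\int_{[0,1)}\frac{f(t)}{1-tz}\,d\mu(t)$, $z\in\mathbb D$ (under the integrability hypothesis on $\mu$ it is well defined, with analytic values, on every $Q_s$, $s>0$). A positive Borel measure $\nu$ on $[0,1)$ is a Carleson measure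 if there is $C>0$ with $\nu([t,1))\le C(1-t)$ for all $0\le t<1$. *)

theory Defs
  imports "HOL-Analysis.Analysis"
begin

abbreviation unit_disc :: "complex set" where
  "unit_disc \<equiv> ball 0 1"

definition disc_area :: "complex measure" where
  "disc_area = scale_measure (ennreal (1 / pi)) (restrict_space lborel unit_disc)"

definition ennsqrt :: "ennreal \<Rightarrow> ennreal" where
  "ennsqrt x = (if x = \<infinity> then \<infinity> else ennreal (sqrt (enn2real x)))"

text \<open>All norms below take values in \<^typ>\<open>ennreal\<close>; a holomorphic function lies in the
  corresponding space iff its norm is finite. Elements of the spaces are functions on all of
  \<^typ>\<open>complex\<close>, of which only the values on the unit disc matter.\<close>

text \<open>The Green function. At \<open>z = a\<close>, where it should be infinite, the value is 0; this single
  point is irrelevant for the integrals below.\<close>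

definition green :: "complex \<Rightarrow> complex \<Rightarrow> real" where
  "green z a = ln (cmod ((1 - cnj a * z) / (z - a)))"

definition Q_seminorm :: "real \<Rightarrow> (complex \<Rightarrow> complex) \<Rightarrow> ennreal" where
  "Q_seminorm s f = ennsqrt (SUP a\<in>unit_disc.
     \<integral>\<^sup>+ z. ennreal ((cmod (deriv f z))\<^sup>2 * green z a powr s) \<partial>disc_area)"

definition Q_norm :: "real \<Rightarrow> (complex \<Rightarrow> complex) \<Rightarrow> ennreal" where
  "Q_norm s f = ennsqrt (ennreal ((cmod (f 0))\<^sup>2) + (Q_seminorm s f)\<^sup>2)"

definition Q_space :: "real \<Rightarrow> (complex \<Rightarrow> complex) set" where
  "Q_space s = {f. f holomorphic_on unit_disc \<and> Q_norm s f < \<infinity>}"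

definition disc_aut :: "complex \<Rightarrow> complex \<Rightarrow> complex" where
  "disc_aut a z = (a - z) / (1 - cnj a * z)"

definition H2_norm :: "(complex \<Rightarrow> complex) \<Rightarrow> ennreal" where
  "H2_norm f = (SUP r\<in>{0..<1::real}. ennsqrt (ennreal (1 / (2 * pi)) *
     (\<integral>\<^sup>+ \<theta>\<in>{0..2*pi}. ennreal ((cmod (f (of_real r * cis \<theta>)))\<^sup>2) \<partial>lborel)))"

definition BMOA_norm :: "(complex \<Rightarrow> complex) \<Rightarrow> ennreal" where
  "BMOA_norm f = ennreal (cmod (f 0)) +
     (SUP a\<in>unit_disc. H2_norm (\<lambda>z. f (disc_aut a z) - f a))"

definition BMOA :: "(complex \<Rightarrow> complex) set" where
  "BMOA = {f. f holomorphic_on unit_disc \<and> BMOA_norm f < \<infinity>}"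

definition I_op :: "real measure \<Rightarrow> (complex \<Rightarrow> complex) \<Rightarrow> complex \<Rightarrow> complex" where
  "I_op \<mu> f z = (\<integral>t. f (of_real t) / (1 - of_real t * z) \<partial>\<mu>)"

definition bounded_operator ::
  "(complex \<Rightarrow> complex) set \<Rightarrow> ((complex \<Rightarrow> complex) \<Rightarrow> ennreal) \<Rightarrow>
   (complex \<Rightarrow> complex) set \<Rightarrow> ((complex \<Rightarrow> complex) \<Rightarrow> ennreal) \<Rightarrow>
   ((complex \<Rightarrow> complex) \<Rightarrow> complex \<Rightarrow> complex) \<Rightarrow> bool" where
  "bounded_operator X normX Y normY T \<longleftrightarrow>
     (\<forall>f\<in>X. T f \<in> Y) \<and> (\<exists>C::real. C \<ge> 0 \<and> (\<forall>f\<in>X. normY (T f) \<le> ennreal C * normX f))"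

definition borel_measure_01 :: "real measure \<Rightarrow> bool" where
  "borel_measure_01 \<mu> \<longleftrightarrow> sets \<mu> = sets (restrict_space borel {0..<1})"

definition carleson_measure :: "real measure \<Rightarrow> bool" where
  "carleson_measure \<nu> \<longleftrightarrow> borel_measure_01 \<nu> \<and>
     (\<exists>C::real. C > 0 \<and> (\<forall>t\<in>{0..<1}. emeasure \<nu> {t..<1} \<le> ennreal (C * (1 - t))))"

end

theory Submission
  imports Defs "HOL-Complex_Analysis.Complex_Analysis"
begin

text \<open>Write \<open>L t = ln (2 / (1 - t))\<close> and let \<open>\<nu>\<close> be the measure with density \<open>L\<close> with respect to \<open>\<mu>\<close>.
  Both directions rest on one computation. For a disc automorphism \<open>\<phi>\<close> (here \<^const>\<open>disc_aut\<close> \<open>a\<close>)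
  the Cauchy kernel satisfies
  \<open>1 / (1 - t \<phi> z) - 1 / (1 - t a) = - z (1 - \<bar>a\<bar>\<^sup>2) t / ((1 - t a)\<^sup>2 (1 - b z))\<close>, where \<open>b\<close> depends on
  \<open>a\<close> and \<open>t\<close>, \<open>\<bar>b\<bar> < 1\<close> and \<open>1 - \<bar>b\<bar>\<^sup>2 = (1 - t\<^sup>2) (1 - \<bar>a\<bar>\<^sup>2) / \<bar>1 - t a\<bar>\<^sup>2\<close>
  (\<open>cauchy_kernel_disc_aut\<close>, \<open>one_minus_cmod_mobius_coeff\<close>). So the functions whose Hardy norms
  make up the BMOA norm of a Cauchy transform are again superpositions of Cauchy kernels, and the
  Hardy norm of a single kernel \<open>1 / (1 - b z)\<close> is \<open>(1 - \<bar>b\<bar>\<^sup>2)\<close> to the power \<open>-1/2\<close>.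

  Suppose that \<open>\<nu>\<close> is a Carleson measure. A function \<open>f\<close> in \<open>Q\<^sub>s\<close> is a Bloch function, hence
  \<open>\<bar>f t\<bar>\<close> is at most a multiple of \<open>\<parallel>f\<parallel> L t\<close> (\<open>Q_space_growth\<close>), and \<open>I_op \<mu> f\<close> is the Cauchy
  transform of \<open>v \<nu>\<close> with the bounded function \<open>v = f / L\<close>. By the integral form of Minkowski's inequality
  the Hardy norm of \<open>I_op \<mu> f \<circ> \<phi> - I_op \<mu> f a\<close> is at most a multiple of
  \<open>\<integral> sqrt ((1 - \<bar>a\<bar>\<^sup>2) / (1 - t\<^sup>2)) / \<bar>1 - t a\<bar> d\<nu> t\<close>, and the Carleson condition bounds this integral
  independently of \<open>a\<close> (\<open>carleson_cauchy_transform_BMOA\<close>).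

  Conversely, it suffices to use a single exponent and a single function. The function
  \<open>ln (2 / (1 - z))\<close> lies in \<open>Q\<^sub>2\<close> (\<open>log_fun_in_Q_space\<close>), and its image under \<open>I_op \<mu>\<close> is the Cauchy
  transform of \<open>\<nu>\<close> itself. For real \<open>a\<close> the Hardy norm in the definition of BMOA dominates the first Taylor
  coefficient, which is \<open>(1 - a\<^sup>2) \<integral> t / (1 - t a)\<^sup>2 d\<nu> t\<close> up to sign; on \<open>[a, 1)\<close> the integrand is of
  size \<open>(1 - a)\<close> to the power \<open>-2\<close>, so that \<open>\<nu> [a, 1)\<close> is at most a multiple of \<open>1 - a\<close>
  (\<open>BMOA_imp_carleson\<close>).\<close>

section \<open>Two integral inequalities\<close>

text \<open>The layer cake formula without an antiderivative: a decreasing function \<open>m\<close> satisfies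
  \<open>r m (2 r) \<le> \<integral> m\<close>, the integral taken over \<open>(r, 2 r]\<close> only. Thus a kernel of the form \<open>r m (2 r)\<close>,
  which for power-like \<open>m\<close> is \<open>r m r\<close> up to a constant, is integrated by counting the mass where
  \<open>r < h\<close>. It serves twice: for a Carleson measure, whose mass near \<open>1\<close> is controlled,
  and for area, where it replaces polar coordinates.\<close>

lemma nn_integral_le_layer_cake:
  fixes M :: "'a measure" and r :: "'a \<Rightarrow> real" and m :: "real \<Rightarrow> real"
  assumes "sigma_finite_measure M"
    and [measurable]: "r \<in> borel_measurable M" "m \<in> borel_measurable borel"
    and r: "\<And>x. x \<in> space M \<Longrightarrow> r x \<ge> 0"
    and m: "\<And>h k. 0 < h \<Longrightarrow> h \<le> k \<Longrightarrow> m k \<le> m h"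
  shows "(\<integral>\<^sup>+x. ennreal (r x * m (2 * r x)) \<partial>M)
           \<le> (\<integral>\<^sup>+h. ennreal (m h) * indicator {0..} h * emeasure M {x \<in> space M. r x < h} \<partial>lborel)"
proof -
  interpret M: sigma_finite_measure M by fact
  interpret pair_sigma_finite M "lborel :: real measure" ..
  have "ennreal (r x * m (2 * r x))
          \<le> (\<integral>\<^sup>+h. ennreal (m h) * indicator {0..} h * indicator {x \<in> space M. r x < h} x \<partial>lborel)"
    if x: "x \<in> space M" for x
  proof -
    have "ennreal (r x * m (2 * r x)) = (\<integral>\<^sup>+h. ennreal (m (2 * r x)) * indicator {r x<..2 * r x} h \<partial>lborel)"
      using r[OF x] by (simp add: nn_integral_cmult_indicator ennreal_mult' mult.commute)
    also have "\<dots> \<le> (\<integral>\<^sup>+h. ennreal (m h) * indicator {0..} h * indicator {x \<in> space M. r x < h} x \<partial>lborel)"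
      using x r[OF x]
      by (intro nn_integral_mono) (auto split: split_indicator intro!: ennreal_leI m)
    finally show ?thesis .
  qed
  then have "(\<integral>\<^sup>+x. ennreal (r x * m (2 * r x)) \<partial>M) \<le>
      (\<integral>\<^sup>+x. \<integral>\<^sup>+h. ennreal (m h) * indicator {0..} h * indicator {x \<in> space M. r x < h} x \<partial>lborel \<partial>M)"
    by (intro nn_integral_mono)
  also have "\<dots> = (\<integral>\<^sup>+h. \<integral>\<^sup>+x. ennreal (m h) * indicator {0..} h * indicator {x \<in> space M. r x < h} x \<partial>M \<partial>lborel)"
  proof (rule Fubini'[symmetric])
    show "(\<lambda>(x, h). ennreal (m h) * indicator {0..} h * indicator {x \<in> space M. r x < h} x)
            \<in> borel_measurable (M \<Otimes>\<^sub>M lborel)"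
      by measurable
  qed
  also have "\<dots> = (\<integral>\<^sup>+h. ennreal (m h) * indicator {0..} h * emeasure M {x \<in> space M. r x < h} \<partial>lborel)"
    by (intro nn_integral_cong) (simp add: nn_integral_cmult_indicator)
  finally show ?thesis .
qed

text \<open>Minkowski's integral inequality in \<open>L\<^sup>2\<close>, in the form where bounds \<open>w x\<close> for the norms of the
  slices are given. Splitting \<open>k = sqrt w * (k / sqrt w)\<close> and applying the Cauchy-Schwarz inequality in \<open>x\<close>
  leaves an integral that Tonelli's theorem evaluates slice by slice.\<close>

lemma nn_integral_Minkowski_L2:
  fixes k :: "'a \<Rightarrow> 'b \<Rightarrow> real"
  assumes "sigma_finite_measure M" "sigma_finite_measure N"
    and k[measurable]: "case_prod k \<in> borel_measurable (M \<Otimes>\<^sub>M N)"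
    and w[measurable]: "w \<in> borel_measurable M"
    and w0: "\<And>x. x \<in> space M \<Longrightarrow> w x > 0"
    and k0: "\<And>x y. x \<in> space M \<Longrightarrow> y \<in> space N \<Longrightarrow> k x y \<ge> 0"
    and kw: "\<And>x. x \<in> space M \<Longrightarrow> (\<integral>\<^sup>+y. ennreal ((k x y)\<^sup>2) \<partial>N) \<le> ennreal ((w x)\<^sup>2)"
  shows "(\<integral>\<^sup>+y. (\<integral>\<^sup>+x. ennreal (k x y) \<partial>M)\<^sup>2 \<partial>N) \<le> (\<integral>\<^sup>+x. ennreal (w x) \<partial>M)\<^sup>2"
proof -
  interpret M: sigma_finite_measure M by fact
  interpret N: sigma_finite_measure N by fact
  interpret pair_sigma_finite M N ..
  let ?W = "\<integral>\<^sup>+x. ennreal (w x) \<partial>M"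
  have [measurable]: "k x \<in> borel_measurable N" if "x \<in> space M" for x
    using measurable_compose_Pair1[OF that k] by simp
  have "(\<integral>\<^sup>+x. ennreal (k x y) \<partial>M)\<^sup>2 \<le> ?W * (\<integral>\<^sup>+x. ennreal ((k x y)\<^sup>2 / w x) \<partial>M)"
    if y: "y \<in> space N" for y
  proof -
    have [measurable]: "(\<lambda>x. k x y) \<in> borel_measurable M"
      using measurable_compose[OF measurable_Pair2'[OF y] k] by simp
    have "(\<integral>\<^sup>+x. ennreal (k x y) \<partial>M) = (\<integral>\<^sup>+x. ennreal (sqrt (w x)) * ennreal (k x y / sqrt (w x)) \<partial>M)"
      by (intro nn_integral_cong) (use w0 k0 y in \<open>auto simp flip: ennreal_mult simp: less_imp_neq[symmetric] less_imp_le\<close>)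
    also have "\<dots>\<^sup>2 \<le> (\<integral>\<^sup>+x. (ennreal (sqrt (w x)))\<^sup>2 \<partial>M) * (\<integral>\<^sup>+x. (ennreal (k x y / sqrt (w x)))\<^sup>2 \<partial>M)"
      by (rule Cauchy_Schwarz_nn_integral) auto
    also have "(\<integral>\<^sup>+x. (ennreal (sqrt (w x)))\<^sup>2 \<partial>M) = ?W"
      by (intro nn_integral_cong) (use w0 in \<open>auto simp: ennreal_power less_imp_le\<close>)
    also have "(\<integral>\<^sup>+x. (ennreal (k x y / sqrt (w x)))\<^sup>2 \<partial>M) = (\<integral>\<^sup>+x. ennreal ((k x y)\<^sup>2 / w x) \<partial>M)"
      by (intro nn_integral_cong) (use w0 k0 y in \<open>auto simp: ennreal_power less_imp_le power_divide\<close>)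
    finally show ?thesis .
  qed
  then have "(\<integral>\<^sup>+y. (\<integral>\<^sup>+x. ennreal (k x y) \<partial>M)\<^sup>2 \<partial>N)
      \<le> (\<integral>\<^sup>+y. ?W * (\<integral>\<^sup>+x. ennreal ((k x y)\<^sup>2 / w x) \<partial>M) \<partial>N)"
    by (intro nn_integral_mono)
  also have "\<dots> = ?W * (\<integral>\<^sup>+y. \<integral>\<^sup>+x. ennreal ((k x y)\<^sup>2 / w x) \<partial>M \<partial>N)"
    by (rule nn_integral_cmult) measurable
  also have "(\<integral>\<^sup>+y. \<integral>\<^sup>+x. ennreal ((k x y)\<^sup>2 / w x) \<partial>M \<partial>N) = (\<integral>\<^sup>+x. \<integral>\<^sup>+y. ennreal ((k x y)\<^sup>2 / w x) \<partial>N \<partial>M)"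
    by (rule Fubini') measurable
  also have "\<dots> \<le> ?W"
  proof (rule nn_integral_mono)
    fix x assume x: "x \<in> space M"
    have "(\<integral>\<^sup>+y. ennreal ((k x y)\<^sup>2 / w x) \<partial>N) = (\<integral>\<^sup>+y. ennreal (1 / w x) * ennreal ((k x y)\<^sup>2) \<partial>N)"
      using w0[OF x] by (intro nn_integral_cong) (simp flip: ennreal_mult)
    also have "\<dots> = ennreal (1 / w x) * (\<integral>\<^sup>+y. ennreal ((k x y)\<^sup>2) \<partial>N)"
      using x by (intro nn_integral_cmult) measurable
    also have "\<dots> \<le> ennreal (1 / w x) * ennreal ((w x)\<^sup>2)"
      by (intro mult_left_mono kw x) auto
    also have "\<dots> = ennreal (w x)"
      using w0[OF x] by (simp flip: ennreal_mult add: power2_eq_square)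
    finally show "(\<integral>\<^sup>+y. ennreal ((k x y)\<^sup>2 / w x) \<partial>N) \<le> ennreal (w x)" .
  qed
  then have "?W * (\<integral>\<^sup>+x. \<integral>\<^sup>+y. ennreal ((k x y)\<^sup>2 / w x) \<partial>N \<partial>M) \<le> ?W\<^sup>2"
    by (auto simp: power2_eq_square intro: mult_left_mono)
  finally show ?thesis .
qed

section \<open>Mean values over circles and discs\<close>

lemma lborel_complex_eq_distr:
  "lborel = distr (lborel \<Otimes>\<^sub>M lborel) borel (\<lambda>(x, y). Complex x y)"
proof (rule lborel_eqI)
  fix l u :: complex
  assume le: "\<And>b. b \<in> Basis \<Longrightarrow> l \<bullet> b \<le> u \<bullet> b"
  have *: "(\<lambda>(x, y). Complex x y) -` box l u = {Re l<..<Re u} \<times> {Im l<..<Im u}"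
    by (auto simp: box_def Basis_complex_def)
  have [measurable]: "(\<lambda>(x, y). Complex x y) \<in> borel_measurable (lborel \<Otimes>\<^sub>M lborel)"
    unfolding lborel_prod measurable_lborel1 measurable_lborel2 case_prod_beta'
    by (intro borel_measurable_continuous_onI continuous_intros)
  have "Re l \<le> Re u" "Im l \<le> Im u"
    using le[of 1] le[of \<i>] by (auto simp: Basis_complex_def)
  then show "emeasure (distr (lborel \<Otimes>\<^sub>M lborel) borel (\<lambda>(x, y). Complex x y)) (box l u) = (\<Prod>b\<in>Basis. (u - l) \<bullet> b)"
    by (subst emeasure_distr)
       (auto simp: * space_pair_measure lborel.emeasure_pair_measure_Times Basis_complex_def ennreal_mult)
qed simp

lemma nn_integral_lborel_complex:
  assumes [measurable]: "f \<in> borel_measurable borel"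
  shows "(\<integral>\<^sup>+z. f z \<partial>lborel) = (\<integral>\<^sup>+x. \<integral>\<^sup>+y. f (Complex x y) \<partial>lborel \<partial>lborel)"
proof -
  have [measurable]: "(\<lambda>(x, y). Complex x y) \<in> borel_measurable (lborel \<Otimes>\<^sub>M lborel)"
    unfolding lborel_prod measurable_lborel1 measurable_lborel2 case_prod_beta'
    by (intro borel_measurable_continuous_onI continuous_intros)
  show ?thesis
    by (subst lborel_complex_eq_distr)
       (simp add: nn_integral_distr case_prod_beta' lborel.nn_integral_fst[symmetric])
qed

text \<open>Fubini's theorem and one affine substitution in each coordinate prove this if \<open>Re w \<noteq> 0\<close>. The remaining
  rotations by a right angle are squares of rotations of this kind.\<close>

lemma nn_integral_lborel_rotate:
  fixes w :: complex
  assumes f[measurable]: "f \<in> borel_measurable borel" and w: "cmod w = 1"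
  shows "(\<integral>\<^sup>+z. f (w * z) \<partial>lborel) = (\<integral>\<^sup>+z. f z \<partial>lborel)"
proof -
  have C[measurable]: "(\<lambda>(x, y). Complex x y) \<in> borel_measurable (borel \<Otimes>\<^sub>M borel)"
    unfolding borel_prod case_prod_beta'
    by (intro borel_measurable_continuous_onI continuous_intros)
  have [measurable]: "(\<lambda>x. Complex (p x) (q x)) \<in> borel_measurable M"
    if "p \<in> borel_measurable M" "q \<in> borel_measurable M" for M :: "'b measure" and p q
    using measurable_compose[OF measurable_Pair[OF that] C] by simp
  have main: "(\<integral>\<^sup>+z. g (v * z) \<partial>lborel) = (\<integral>\<^sup>+z. g z \<partial>lborel)"
    if g[measurable]: "g \<in> borel_measurable borel" and v: "cmod v = 1" "Re v \<noteq> 0"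
    for g :: "complex \<Rightarrow> ennreal" and v
  proof -
    let ?a = "Re v" and ?b = "Im v"
    have ab: "?a\<^sup>2 + ?b\<^sup>2 = 1"
      using v(1) by (metis cmod_power2 one_power2)
    have eq: "v * Complex x y = Complex (?a * x - ?b * y) (?b * x + ?a * y)" for x y
      by (simp add: complex_eq_iff algebra_simps)
    have "(\<integral>\<^sup>+z. g (v * z) \<partial>lborel) = (\<integral>\<^sup>+x. \<integral>\<^sup>+y. g (Complex (?a * x - ?b * y) (?b * x + ?a * y)) \<partial>lborel \<partial>lborel)"
      by (subst nn_integral_lborel_complex) (auto simp: eq)
    also have "\<dots> = (\<integral>\<^sup>+y. \<integral>\<^sup>+x. g (Complex (?a * x - ?b * y) (?b * x + ?a * y)) \<partial>lborel \<partial>lborel)"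
      by (rule lborel_pair.Fubini'[symmetric]) measurable
    also have "\<dots> = (\<integral>\<^sup>+y. \<bar>1 / ?a\<bar> * (\<integral>\<^sup>+u. g (Complex u (?b / ?a * u + y / ?a)) \<partial>lborel) \<partial>lborel)"
    proof (rule nn_integral_cong)
      fix y :: real
      have "?b * (?b * y / ?a + u / ?a) + ?a * y = ?b / ?a * u + (?a\<^sup>2 + ?b\<^sup>2) * y / ?a" for u
        using v(2) by (simp add: field_simps power2_eq_square)
      then have "?b * (?b * y / ?a + u / ?a) + ?a * y = ?b / ?a * u + y / ?a" for u
        by (simp add: ab)
      moreover have "?a * (?b * y / ?a + u / ?a) - ?b * y = u" for u
        using v(2) by (simp add: field_simps)
      ultimately show "(\<integral>\<^sup>+x. g (Complex (?a * x - ?b * y) (?b * x + ?a * y)) \<partial>lborel)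
          = \<bar>1 / ?a\<bar> * (\<integral>\<^sup>+u. g (Complex u (?b / ?a * u + y / ?a)) \<partial>lborel)"
        by (subst nn_integral_real_affine[where c = "1 / ?a" and t = "?b * y / ?a"]) (use v(2) in auto)
    qed
    also have "\<dots> = \<bar>1 / ?a\<bar> * (\<integral>\<^sup>+y. \<integral>\<^sup>+u. g (Complex u (?b / ?a * u + y / ?a)) \<partial>lborel \<partial>lborel)"
      by (rule nn_integral_cmult) measurable
    also have "(\<integral>\<^sup>+y. \<integral>\<^sup>+u. g (Complex u (?b / ?a * u + y / ?a)) \<partial>lborel \<partial>lborel)
        = (\<integral>\<^sup>+u. \<integral>\<^sup>+y. g (Complex u (?b / ?a * u + y / ?a)) \<partial>lborel \<partial>lborel)"
      by (rule lborel_pair.Fubini') measurable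
    also have "\<bar>1 / ?a\<bar> * \<dots> = (\<integral>\<^sup>+u. \<bar>1 / ?a\<bar> * (\<integral>\<^sup>+y. g (Complex u (?b / ?a * u + y / ?a)) \<partial>lborel) \<partial>lborel)"
      by (rule nn_integral_cmult[symmetric]) measurable
    also have "\<dots> = (\<integral>\<^sup>+u. \<integral>\<^sup>+y. g (Complex u y) \<partial>lborel \<partial>lborel)"
    proof (rule nn_integral_cong)
      fix u :: real
      show "\<bar>1 / ?a\<bar> * (\<integral>\<^sup>+y. g (Complex u (?b / ?a * u + y / ?a)) \<partial>lborel) = (\<integral>\<^sup>+y. g (Complex u y) \<partial>lborel)"
        by (subst (2) nn_integral_real_affine[where c = "1 / ?a" and t = "?b / ?a * u"]) (use v(2) in auto)
    qed
    finally show ?thesis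
      by (simp add: nn_integral_lborel_complex)
  qed
  show ?thesis
  proof (cases "Re w = 0")
    case False
    with main[OF f w] show ?thesis by simp
  next
    case True
    \<comment> \<open>Here \<open>w = \<plusminus>\<i>\<close>, and its square root has a nonzero real part.\<close>
    define v where "v = csqrt w"
    have v: "w = v * v" "cmod v = 1"
      using w by (auto simp: v_def norm_csqrt simp flip: power2_eq_square)
    have "Re v \<noteq> 0"
    proof
      assume "Re v = 0"
      then have "Im w = 0" using v(1) by simp
      with True w show False by (simp add: cmod_def)
    qed
    with v main[of "\<lambda>z. f (v * z)" v] main[of f v] show ?thesis
      by (simp add: mult.assoc)
  qed
qed

text \<open>Cauchy's integral formula for \<open>\<zeta> \<mapsto> f (a + w \<zeta>)\<close> on the unit circle. The complex number \<open>w\<close> carries the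
  radius together with the starting angle of the circle; a free angle is what the averaging over
  rotations in \<open>disc_square_mean\<close> needs.\<close>

lemma circle_mean_value:
  assumes f: "f holomorphic_on ball a R" and w: "cmod w < R"
  shows "((\<lambda>\<theta>. f (a + w * cis \<theta>)) has_integral 2 * of_real pi * f a) {0..2*pi}"
proof -
  define h where "h \<zeta> = f (a + w * \<zeta>)" for \<zeta>
  have R: "R > 0" using w norm_ge_zero[of w] by linarith
  have mem: "a + w * \<zeta> \<in> ball a R" if "cmod \<zeta> \<le> 1" for \<zeta>
    using that w mult_left_le[of "cmod \<zeta>" "cmod w"] by (simp add: dist_norm norm_mult)
  have "h holomorphic_on cball 0 1"
    unfolding h_def
    by (intro holomorphic_on_compose_gen[OF _ f, unfolded o_def] holomorphic_intros) (use mem in auto)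
  then have "((\<lambda>u. h u / (u - 0)) has_contour_integral (2 * of_real pi * \<i> * h 0)) (circlepath 0 1)"
    by (intro Cauchy_integral_circlepath) (auto intro: holomorphic_on_imp_continuous_on holomorphic_on_subset)
  then have "((\<lambda>t. h (cis t) / cis t * \<i> * cis t) has_integral (2 * of_real pi * \<i> * h 0)) {0..2*pi}"
    unfolding circlepath_def by (subst (asm) has_contour_integral_part_circlepath_iff) auto
  then have "((\<lambda>t. \<i> * h (cis t)) has_integral (2 * of_real pi * \<i> * h 0)) {0..2*pi}"
    by (simp add: mult.commute)
  from has_integral_mult_right[OF this, of "- \<i>"] show ?thesis
    by (simp add: h_def mult_ac)
qed

text \<open>The mean value property of the holomorphic function \<open>f\<^sup>2\<close>.\<close>

lemma circle_square_mean:
  assumes f: "f holomorphic_on ball a R" and w: "cmod w < R"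
  shows "ennreal (2 * pi * (cmod (f a))\<^sup>2) \<le> (\<integral>\<^sup>+\<theta>\<in>{0..2*pi}. ennreal ((cmod (f (a + w * cis \<theta>)))\<^sup>2) \<partial>lborel)"
proof -
  let ?F = "\<lambda>\<theta>. f (a + w * cis \<theta>)"
  have mem: "a + w * cis \<theta> \<in> ball a R" for \<theta>
    using w by (simp add: dist_norm norm_mult)
  have cont: "continuous_on {0..2*pi} (\<lambda>\<theta>. (cmod (?F \<theta>))\<^sup>2)"
    by (intro continuous_intros continuous_on_compose2[OF holomorphic_on_imp_continuous_on[OF f]]) (use mem in auto)
  have "((\<lambda>\<theta>. (?F \<theta>)\<^sup>2) has_integral 2 * of_real pi * (f a)\<^sup>2) {0..2*pi}"
    by (rule circle_mean_value[of "\<lambda>z. (f z)\<^sup>2"]) (use f w in \<open>auto intro!: holomorphic_intros\<close>)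
  then have 1: "integral {0..2*pi} (\<lambda>\<theta>. (?F \<theta>)\<^sup>2) = 2 * of_real pi * (f a)\<^sup>2"
    and 2: "(\<lambda>\<theta>. (?F \<theta>)\<^sup>2) integrable_on {0..2*pi}"
    by (auto simp: has_integral_iff)
  have "norm (2 * of_real pi * (f a)\<^sup>2) \<le> integral {0..2*pi} (\<lambda>\<theta>. (cmod (?F \<theta>))\<^sup>2)"
    unfolding 1[symmetric]
    by (rule integral_norm_bound_integral[OF 2]) (auto intro: integrable_continuous_interval cont simp: norm_power)
  also have "integral {0..2*pi} (\<lambda>\<theta>. (cmod (?F \<theta>))\<^sup>2) = (LBINT \<theta>:{0..2*pi}. (cmod (?F \<theta>))\<^sup>2)"
    by (intro set_borel_integral_eq_integral(2)[symmetric] borel_integrable_atLeastAtMost' cont)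
  finally have "2 * pi * (cmod (f a))\<^sup>2 \<le> (LBINT \<theta>:{0..2*pi}. (cmod (?F \<theta>))\<^sup>2)"
    by (simp add: norm_mult norm_power)
  then have "ennreal (2 * pi * (cmod (f a))\<^sup>2) \<le> ennreal (LBINT \<theta>:{0..2*pi}. (cmod (?F \<theta>))\<^sup>2)"
    by (rule ennreal_leI)
  also have "\<dots> = (\<integral>\<^sup>+\<theta>. ennreal (indicator {0..2*pi} \<theta> * (cmod (?F \<theta>))\<^sup>2) \<partial>lborel)"
    unfolding set_lebesgue_integral_def real_scaleR_def
    using borel_integrable_atLeastAtMost'[OF cont]
    by (intro nn_integral_eq_integral[symmetric]) (auto simp: set_integrable_def)
  also have "\<dots> = (\<integral>\<^sup>+\<theta>\<in>{0..2*pi}. ennreal ((cmod (?F \<theta>))\<^sup>2) \<partial>lborel)"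
    by (intro nn_integral_cong) (auto split: split_indicator)
  finally show ?thesis .
qed

lemma borel_measurable_square_cmod_disc:
  assumes "continuous_on (ball a R) f"
  shows "(\<lambda>z. ennreal ((cmod (f z))\<^sup>2) * indicator (ball a R) z) \<in> borel_measurable borel"
proof -
  have "(\<lambda>z. indicator (ball a R) z *\<^sub>R (cmod (f z))\<^sup>2) \<in> borel_measurable borel"
    by (intro borel_measurable_continuous_on_indicator) (auto intro!: continuous_intros assms)
  then have "(\<lambda>z. ennreal (indicator (ball a R) z *\<^sub>R (cmod (f z))\<^sup>2)) \<in> borel_measurable borel"
    by measurable
  then show ?thesis
    by (rule measurable_cong[THEN iffD1, rotated]) (auto split: split_indicator)
qed

text \<open>The integral over the disc does not change if the integrand is rotated about the centre. Averaging over
  all rotations and exchanging the integrals puts a circular mean at every point of the disc,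
  to which \<open>circle_square_mean\<close> applies.\<close>

lemma disc_square_mean:
  assumes f: "f holomorphic_on ball a R" and R: "R > 0"
  shows "ennreal (pi * R\<^sup>2 * (cmod (f a))\<^sup>2) \<le> (\<integral>\<^sup>+z\<in>ball a R. ennreal ((cmod (f z))\<^sup>2) \<partial>lborel)"
proof -
  define g where "g z = ennreal ((cmod (f (a + z)))\<^sup>2) * indicator (ball 0 R) z" for z
  have F[measurable]: "(\<lambda>z. ennreal ((cmod (f z))\<^sup>2) * indicator (ball a R) z) \<in> borel_measurable borel"
    by (intro borel_measurable_square_cmod_disc holomorphic_on_imp_continuous_on f)
  have geq: "g z = ennreal ((cmod (f (a + z)))\<^sup>2) * indicator (ball a R) (a + z)" for z
    by (simp add: g_def dist_norm split: split_indicator)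
  have [measurable]: "g \<in> borel_measurable borel"
    unfolding geq[abs_def] by (rule measurable_compose[OF _ F]) measurable
  have shift: "(\<integral>\<^sup>+z\<in>ball a R. ennreal ((cmod (f z))\<^sup>2) \<partial>lborel) = (\<integral>\<^sup>+z. g z \<partial>lborel)"
    unfolding geq by (subst lborel_distr_plus[of a, symmetric]) (simp add: nn_integral_distr)
  have "ennreal (2 * pi) * ennreal (pi * R\<^sup>2 * (cmod (f a))\<^sup>2)
      = (\<integral>\<^sup>+z. ennreal (2 * pi * (cmod (f a))\<^sup>2) * indicator (ball (0::complex) R) z \<partial>lborel)"
  proof -
    have "(\<integral>\<^sup>+z. ennreal (2 * pi * (cmod (f a))\<^sup>2) * indicator (ball (0::complex) R) z \<partial>lborel)
        = ennreal (2 * pi * (cmod (f a))\<^sup>2) * ennreal (pi * R\<^sup>2)"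
      using R by (subst nn_integral_cmult_indicator) (auto simp: emeasure_ball unit_ball_vol_2)
    also have "\<dots> = ennreal (2 * pi * (cmod (f a))\<^sup>2 * (pi * R\<^sup>2))"
      by (rule ennreal_mult[symmetric]) auto
    also have "2 * pi * (cmod (f a))\<^sup>2 * (pi * R\<^sup>2) = 2 * pi * (pi * R\<^sup>2 * (cmod (f a))\<^sup>2)"
      by (simp only: mult_ac)
    also have "ennreal \<dots> = ennreal (2 * pi) * ennreal (pi * R\<^sup>2 * (cmod (f a))\<^sup>2)"
      by (rule ennreal_mult) auto
    finally show ?thesis ..
  qed
  also have "\<dots> \<le> (\<integral>\<^sup>+z. \<integral>\<^sup>+\<theta>. g (cis \<theta> * z) * indicator {0..2*pi} \<theta> \<partial>lborel \<partial>lborel)"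
  proof (rule nn_integral_mono)
    fix z :: complex
    show "ennreal (2 * pi * (cmod (f a))\<^sup>2) * indicator (ball 0 R) z
        \<le> (\<integral>\<^sup>+\<theta>. g (cis \<theta> * z) * indicator {0..2*pi} \<theta> \<partial>lborel)"
    proof (cases "cmod z < R")
      case True
      then have "g (cis \<theta> * z) = ennreal ((cmod (f (a + z * cis \<theta>)))\<^sup>2)" for \<theta>
        by (simp add: g_def norm_mult mult.commute)
      with circle_square_mean[OF f True] True show ?thesis
        by simp
    qed simp
  qed
  also have "\<dots> = (\<integral>\<^sup>+\<theta>. \<integral>\<^sup>+z. g (cis \<theta> * z) * indicator {0..2*pi} \<theta> \<partial>lborel \<partial>lborel)"
  proof (rule lborel_pair.Fubini'[symmetric])
    have [measurable]: "cis \<in> borel_measurable borel"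
      by (intro borel_measurable_continuous_onI continuous_intros)
    show "(\<lambda>(z, \<theta>). g (cis \<theta> * z) * indicator {0..2*pi} \<theta>) \<in> borel_measurable (lborel \<Otimes>\<^sub>M lborel)"
      by measurable
  qed
  also have "\<dots> = (\<integral>\<^sup>+\<theta>. (\<integral>\<^sup>+z. g z \<partial>lborel) * indicator {0..2*pi} \<theta> \<partial>lborel)"
  proof (rule nn_integral_cong)
    fix \<theta> :: real
    have "(\<integral>\<^sup>+z. g (cis \<theta> * z) * indicator {0..2*pi} \<theta> \<partial>lborel)
        = (\<integral>\<^sup>+z. g (cis \<theta> * z) \<partial>lborel) * indicator {0..2*pi} \<theta>"
      by (rule nn_integral_multc) measurable
    also have "(\<integral>\<^sup>+z. g (cis \<theta> * z) \<partial>lborel) = (\<integral>\<^sup>+z. g z \<partial>lborel)"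
      by (rule nn_integral_lborel_rotate) auto
    finally show "(\<integral>\<^sup>+z. g (cis \<theta> * z) * indicator {0..2*pi} \<theta> \<partial>lborel)
        = (\<integral>\<^sup>+z. g z \<partial>lborel) * indicator {0..2*pi} \<theta>" .
  qed
  also have "\<dots> = ennreal (2 * pi) * (\<integral>\<^sup>+z. g z \<partial>lborel)"
    by (simp add: nn_integral_cmult_indicator mult.commute)
  finally show ?thesis
    unfolding shift by (subst (asm) ennreal_mult_le_mult_iff) auto
qed

section \<open>Functions in \<open>Q\<^sub>s\<close> grow at most logarithmically\<close>

lemma power2_ennsqrt: "(ennsqrt x)\<^sup>2 = x"
  by (cases x) (auto simp: ennsqrt_def ennreal_power)

lemma ennsqrt_mono: "x \<le> y \<Longrightarrow> ennsqrt x \<le> ennsqrt y"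
  by (cases x; cases y) (auto simp: ennsqrt_def top_unique intro!: ennreal_leI)

lemma ennsqrt_ennreal: "x \<ge> 0 \<Longrightarrow> ennsqrt (ennreal x) = ennreal (sqrt x)"
  by (simp add: ennsqrt_def)

lemma nn_integral_disc_area:
  assumes "h \<in> borel_measurable (restrict_space borel unit_disc)"
  shows "(\<integral>\<^sup>+z. h z \<partial>disc_area) = ennreal (1 / pi) * (\<integral>\<^sup>+z\<in>unit_disc. h z \<partial>lborel)"
proof -
  have "h \<in> borel_measurable (restrict_space lborel unit_disc)"
    using assms by (simp cong: measurable_cong_sets add: sets_restrict_space)
  then show ?thesis
    unfolding disc_area_def by (simp add: nn_integral_scale_measure nn_integral_restrict_space)
qed

lemma borel_measurable_Q_integrand:
  assumes "f holomorphic_on unit_disc"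
  shows "(\<lambda>z. ennreal ((cmod (deriv f z))\<^sup>2 * green z a powr s)) \<in> borel_measurable (restrict_space borel unit_disc)"
proof -
  have [measurable]: "deriv f \<in> borel_measurable (restrict_space borel unit_disc)"
    by (intro borel_measurable_continuous_on_restrict holomorphic_on_imp_continuous_on holomorphic_deriv assms open_ball)
  have [measurable]: "(\<lambda>z. z) \<in> restrict_space borel unit_disc \<rightarrow>\<^sub>M borel"
    by (rule measurable_restrict_space1) simp
  show ?thesis
    unfolding green_def by measurable
qed

lemma Q_spaceD:
  assumes "f \<in> Q_space s"
  defines "N \<equiv> enn2real (Q_norm s f)"
  shows "f holomorphic_on unit_disc" "Q_norm s f = ennreal N" "N \<ge> 0" "cmod (f 0) \<le> N"
    "\<And>a. a \<in> unit_disc \<Longrightarrow> (\<integral>\<^sup>+z. ennreal ((cmod (deriv f z))\<^sup>2 * green z a powr s) \<partial>disc_area) \<le> ennreal (N\<^sup>2)"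
proof -
  show "f holomorphic_on unit_disc" and eq: "Q_norm s f = ennreal N" and N: "N \<ge> 0"
    using assms by (auto simp: Q_space_def)
  let ?S = "SUP a\<in>unit_disc. \<integral>\<^sup>+z. ennreal ((cmod (deriv f z))\<^sup>2 * green z a powr s) \<partial>disc_area"
  have sum: "ennreal (N\<^sup>2) = ennreal ((cmod (f 0))\<^sup>2) + ?S"
    using eq N power2_ennsqrt[of "ennreal ((cmod (f 0))\<^sup>2) + (Q_seminorm s f)\<^sup>2"]
    by (simp add: Q_norm_def Q_seminorm_def power2_ennsqrt ennreal_power)
  then have "ennreal ((cmod (f 0))\<^sup>2) \<le> ennreal (N\<^sup>2)"
    by simp
  then show "cmod (f 0) \<le> N"
    using N by (simp add: abs_le_square_iff[symmetric])
  have "?S \<le> ennreal (N\<^sup>2)"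
    using sum by simp
  then show "(\<integral>\<^sup>+z. ennreal ((cmod (deriv f z))\<^sup>2 * green z a powr s) \<partial>disc_area) \<le> ennreal (N\<^sup>2)"
    if "a \<in> unit_disc" for a
    using that by (meson SUP_le_iff)
qed

lemma cmod_one_minus_cnj_mult:
  "(cmod (1 - cnj a * z))\<^sup>2 - (cmod (z - a))\<^sup>2 = (1 - (cmod a)\<^sup>2) * (1 - (cmod z)\<^sup>2)"
  by (simp add: cmod_power2 algebra_simps) (simp add: power2_eq_square algebra_simps)

text \<open>The first inequality says that the pseudohyperbolic distance of \<open>a\<close> and \<open>z\<close> is less than \<open>1\<close>.\<close>

lemma one_minus_cnj_mult_lower:
  assumes "cmod a < 1" "cmod z < 1"
  shows "cmod (z - a) < cmod (1 - cnj a * z)" "1 - cmod a \<le> cmod (1 - cnj a * z)" "1 - cmod z \<le> cmod (1 - cnj a * z)"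
proof -
  have "(cmod (1 - cnj a * z))\<^sup>2 - (cmod (z - a))\<^sup>2 = (1 - (cmod a)\<^sup>2) * (1 - (cmod z)\<^sup>2)"
    by (rule cmod_one_minus_cnj_mult)
  also have "\<dots> > 0"
    using assms by (intro mult_pos_pos) (simp_all add: power_less_one_iff)
  finally show "cmod (z - a) < cmod (1 - cnj a * z)"
    by (simp add: power2_less_imp_less)
  have *: "1 - cmod (cnj a * z) \<le> cmod (1 - cnj a * z)"
    using norm_triangle_ineq2[of 1 "cnj a * z"] by simp
  show "1 - cmod a \<le> cmod (1 - cnj a * z)" "1 - cmod z \<le> cmod (1 - cnj a * z)"
    using * assms mult_left_le[of "cmod z" "cmod a"] mult_left_le[of "cmod a" "cmod z"]
    by (auto simp: norm_mult mult.commute)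
qed

text \<open>The Euclidean disc about \<open>a\<close> whose radius is a third of the distance to the unit circle lies in the
  pseudohyperbolic disc of radius \<open>1/2\<close>, where the Green function is at least \<open>ln 2\<close>.\<close>

lemma green_ge_ln2:
  assumes a: "cmod a < 1" and z: "cmod (z - a) < (1 - cmod a) / 3" "z \<noteq> a"
  shows "ln 2 \<le> green z a"
proof -
  have "cmod z \<le> cmod (z - a) + cmod a"
    using norm_triangle_ineq[of "z - a" a] by simp
  with z have "cmod z < 1" "1 - cmod z > 2 * (1 - cmod a) / 3"
    using a by (auto simp: field_simps)
  then have "2 * cmod (z - a) \<le> cmod (1 - cnj a * z)"
    using one_minus_cnj_mult_lower(3)[OF a, of z] z by linarith
  then have "2 \<le> cmod ((1 - cnj a * z) / (z - a))"
    using z(2) by (simp add: norm_divide field_simps)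
  then show ?thesis
    unfolding green_def by (intro iffD2[OF ln_le_cancel_iff]) auto
qed

text \<open>\<open>Q\<^sub>s\<close> is contained in the Bloch space. On the disc of \<open>green_ge_ln2\<close> the weight is at least
  \<open>ln 2 powr s\<close>, so the integral defining the seminorm dominates the area integral of \<open>\<bar>f'\<bar>\<^sup>2\<close> over this disc,
  which in turn dominates \<open>\<bar>f' a\<bar>\<^sup>2\<close> times its area.\<close>

lemma Q_space_deriv_bound:
  assumes f: "f \<in> Q_space s" and s: "s > 0" and a: "cmod a < 1"
  shows "cmod (deriv f a) \<le> 3 / ln 2 powr (s / 2) * enn2real (Q_norm s f) / (1 - cmod a)"
proof -
  define N where "N = enn2real (Q_norm s f)"
  define R where "R = (1 - cmod a) / 3"
  have R: "R > 0" using a by (simp add: R_def)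
  note Q = Q_spaceD[OF f, folded N_def]
  have sub: "ball a R \<subseteq> unit_disc"
  proof
    fix z assume "z \<in> ball a R"
    then have "cmod (z - a) < R" by (simp add: dist_norm norm_minus_commute)
    moreover have "cmod z \<le> cmod (z - a) + cmod a"
      using norm_triangle_ineq[of "z - a" a] by simp
    ultimately show "z \<in> unit_disc"
      using a by (simp add: R_def)
  qed
  have hol: "deriv f holomorphic_on ball a R"
    by (rule holomorphic_on_subset[OF holomorphic_deriv[OF Q(1) open_ball] sub])
  have "ennreal (ln 2 powr s * (1 / pi)) * ennreal (pi * R\<^sup>2 * (cmod (deriv f a))\<^sup>2)
      \<le> ennreal (ln 2 powr s * (1 / pi)) * (\<integral>\<^sup>+z\<in>ball a R. ennreal ((cmod (deriv f z))\<^sup>2) \<partial>lborel)"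
    by (intro mult_left_mono disc_square_mean hol R) auto
  also have "\<dots> = ennreal (1 / pi) * (ennreal (ln 2 powr s) * (\<integral>\<^sup>+z\<in>ball a R. ennreal ((cmod (deriv f z))\<^sup>2) \<partial>lborel))"
    by (subst ennreal_mult) (auto simp: mult_ac)
  also have "\<dots> = ennreal (1 / pi) * (\<integral>\<^sup>+z. ennreal (ln 2 powr s) * (ennreal ((cmod (deriv f z))\<^sup>2) * indicator (ball a R) z) \<partial>lborel)"
    by (subst nn_integral_cmult)
       (auto intro!: borel_measurable_square_cmod_disc holomorphic_on_imp_continuous_on hol)
  also have "\<dots> \<le> ennreal (1 / pi) * (\<integral>\<^sup>+z\<in>unit_disc. ennreal ((cmod (deriv f z))\<^sup>2 * green z a powr s) \<partial>lborel)"
  proof (intro mult_left_mono nn_integral_mono_AE)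
    \<comment> \<open>At \<open>z = a\<close> itself the Green function has the default value \<open>0\<close>.\<close>
    have "AE z in lborel. z \<noteq> a"
      by (rule AE_lborel_singleton)
    then show "AE z in lborel. ennreal (ln 2 powr s) * (ennreal ((cmod (deriv f z))\<^sup>2) * indicator (ball a R) z)
        \<le> ennreal ((cmod (deriv f z))\<^sup>2 * green z a powr s) * indicator unit_disc z"
    proof eventually_elim
      case (elim z)
      show ?case
      proof (cases "z \<in> ball a R")
        case True
        then have "ln 2 \<le> green z a"
          using elim by (intro green_ge_ln2 a) (auto simp: R_def dist_norm norm_minus_commute)
        then have "ln 2 powr s \<le> green z a powr s"
          using s by (intro powr_mono2) auto
        then have "ln 2 powr s * (cmod (deriv f z))\<^sup>2 \<le> (cmod (deriv f z))\<^sup>2 * green z a powr s"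
          by (subst mult.commute) (intro mult_left_mono, auto)
        with True sub show ?thesis
          by (auto simp flip: ennreal_mult intro!: ennreal_leI)
      qed simp
    qed
  qed simp
  also have "\<dots> = (\<integral>\<^sup>+z. ennreal ((cmod (deriv f z))\<^sup>2 * green z a powr s) \<partial>disc_area)"
    by (rule nn_integral_disc_area[symmetric, OF borel_measurable_Q_integrand[OF Q(1)]])
  also have "\<dots> \<le> ennreal (N\<^sup>2)"
    using a by (intro Q(5)) auto
  finally have "ln 2 powr s * (R * cmod (deriv f a))\<^sup>2 \<le> N\<^sup>2"
    by (simp add: power_mult_distrib mult_ac flip: ennreal_mult)
  moreover have "ln 2 powr s = (ln 2 powr (s / 2) :: real)\<^sup>2"
    by (simp add: power2_eq_square flip: powr_add)
  ultimately have "(ln 2 powr (s / 2) * (R * cmod (deriv f a)))\<^sup>2 \<le> N\<^sup>2"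
    by (simp add: power_mult_distrib)
  then have "ln 2 powr (s / 2) * (R * cmod (deriv f a)) \<le> N"
    by (rule power2_le_imp_le) (use Q in auto)
  then show ?thesis
    using a by (simp add: R_def N_def field_simps)
qed

text \<open>Integrating the Bloch bound along \<open>[0, t]\<close> gives the logarithm; the value at \<open>0\<close> is absorbed because
  \<open>ln (2 / (1 - t)) \<ge> ln 2\<close>.\<close>

lemma Q_space_growth:
  assumes f: "f \<in> Q_space s" and s: "s > 0" and t: "0 \<le> t" "t < 1"
  shows "cmod (f (of_real t)) \<le> (1 / ln 2 + 3 / ln 2 powr (s / 2)) * enn2real (Q_norm s f) * ln (2 / (1 - t))"
proof -
  define N where "N = enn2real (Q_norm s f)"
  define c where "c = 3 / ln 2 powr (s / 2)"
  have c: "c \<ge> 0" by (simp add: c_def)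
  note Q = Q_spaceD[OF f, folded N_def]
  have ln1: "ln (2 / (1 - t)) = ln 2 - ln (1 - t)" "ln (1 - t) \<le> 0"
    using t by (auto simp: ln_div)
  have diff: "cmod (f (of_real t) - f 0) \<le> c * N * (- ln (1 - t))"
  proof (cases "t = 0")
    case False
    have "cmod (f (of_real t) - f (of_real 0)) \<le> (c * N * (- ln (1 - t))) - (c * N * (- ln (1 - 0)))"
    proof (rule differentiable_bound_general)
      show "continuous_on {0..t} (\<lambda>x. f (of_real x))"
        by (rule continuous_on_compose2[OF holomorphic_on_imp_continuous_on[OF Q(1)]])
           (use t in \<open>auto intro!: continuous_intros\<close>)
      show "continuous_on {0..t} (\<lambda>x. c * N * (- ln (1 - x)))"
        using t by (intro continuous_intros) auto
      show "((\<lambda>x. f (of_real x)) has_vector_derivative deriv f (of_real x)) (at x)" if "0 < x" "x < t" for x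
      proof -
        have "(f has_field_derivative deriv f (of_real x)) (at (of_real x))"
          by (rule holomorphic_derivI[OF Q(1) open_ball]) (use that t in auto)
        then show ?thesis
          using has_vector_derivative_real_field[of f "deriv f (of_real x)" x UNIV] by simp
      qed
      show "((\<lambda>x. c * N * (- ln (1 - x))) has_vector_derivative c * N / (1 - x)) (at x)" if "0 < x" "x < t" for x
        unfolding has_real_derivative_iff_has_vector_derivative[symmetric]
        by (auto intro!: derivative_eq_intros) (use that t in \<open>auto simp: field_simps\<close>)
      show "cmod (deriv f (of_real x)) \<le> c * N / (1 - x)" if "0 < x" "x < t" for x
        using Q_space_deriv_bound[OF f s, of "of_real x"] that t by (simp add: c_def N_def)
    qed (use t False in auto)
    then show ?thesis by simp
  qed auto
  have "cmod (f (of_real t)) \<le> cmod (f 0) + cmod (f (of_real t) - f 0)"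
    using norm_triangle_ineq[of "f 0" "f (of_real t) - f 0"] by simp
  also have "\<dots> \<le> N + c * N * (- ln (1 - t))"
    by (intro add_mono diff Q)
  also have "\<dots> \<le> N * (ln (2 / (1 - t)) / ln 2) + c * N * ln (2 / (1 - t))"
  proof (intro add_mono mult_left_mono)
    have "1 \<le> ln (2 / (1 - t)) / ln 2"
      using ln1 by simp
    then show "N \<le> N * (ln (2 / (1 - t)) / ln 2)"
      using mult_left_mono[of 1 "ln (2 / (1 - t)) / ln 2" N] Q(3) by linarith
  qed (use ln1 c Q in auto)
  also have "\<dots> = (1 / ln 2 + c) * N * ln (2 / (1 - t))"
    by (simp add: algebra_simps)
  finally show ?thesis
    by (simp add: c_def N_def)
qed

section \<open>Integrals against a Carleson measure\<close>

lemma space_borel_measure_01: "borel_measure_01 \<nu> \<Longrightarrow> space \<nu> = {0..<1}"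
  unfolding borel_measure_01_def by (drule sets_eq_imp_space_eq) (simp add: space_restrict_space)

lemma borel_measurable_borel_measure_01:
  assumes "borel_measure_01 \<nu>" "g \<in> borel_measurable borel"
  shows "g \<in> borel_measurable \<nu>"
proof -
  have "g \<in> borel_measurable (restrict_space borel {0..<1})"
    by (rule measurable_restrict_space1) fact
  with assms(1) show ?thesis
    unfolding borel_measure_01_def by (simp cong: measurable_cong_sets)
qed

text \<open>The value is what the density \<open>C dt\<close> would give up to a constant: the kernel decreases as \<open>t\<close> moves away
  from \<open>1\<close>, so only the mass of the intervals \<open>[t, 1)\<close> matters.\<close>

lemma carleson_nn_integral_bound:
  assumes \<nu>: "borel_measure_01 \<nu>" and C: "C \<ge> 0" and D: "D > 0"
    and carl: "\<And>t. 0 \<le> t \<Longrightarrow> t < 1 \<Longrightarrow> emeasure \<nu> {t..<1} \<le> ennreal (C * (1 - t))"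
  shows "(\<integral>\<^sup>+t. ennreal (1 / (sqrt (1 - t) * ((1 - t) + D))) \<partial>\<nu>) \<le> ennreal (8 * pi * C / sqrt D)"
proof -
  note space[simp] = space_borel_measure_01[OF \<nu>]
  have "emeasure \<nu> (space \<nu>) \<le> ennreal (C * (1 - 0))"
    using carl[of 0] by simp
  then have fin: "finite_measure \<nu>"
    by (intro finite_measureI) (auto simp: top_unique)
  then interpret finite_measure \<nu> .
  \<comment> \<open>The layer cake is applied to \<open>sqrt (1 - t)\<close>, not to \<open>1 - t\<close>: the measure of the layer is then at most \<open>C h\<^sup>2\<close>,
  and the remaining integrand \<open>C / (h\<^sup>2 + D)\<close> is smooth at \<open>0\<close>.\<close>
  define m where "m h = 1 / (h\<^sup>2 * (h\<^sup>2 + D))" for h :: real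
  have "(\<integral>\<^sup>+t. ennreal (1 / (sqrt (1 - t) * ((1 - t) + D))) \<partial>\<nu>)
      \<le> (\<integral>\<^sup>+t. ennreal 16 * ennreal (sqrt (1 - t) * m (2 * sqrt (1 - t))) \<partial>\<nu>)"
  proof (rule nn_integral_mono)
    fix t assume "t \<in> space \<nu>"
    then have q: "sqrt (1 - t) > 0" and t: "t < 1" by auto
    have "16 * (q * (1 / ((2 * q)\<^sup>2 * ((2 * q)\<^sup>2 + D)))) = 4 / (q * (4 * q\<^sup>2 + D))" if "q > 0" for q
      using that D by (simp add: power2_eq_square)
    from this[OF q] have "16 * (sqrt (1 - t) * m (2 * sqrt (1 - t))) = 4 / (sqrt (1 - t) * (4 * (1 - t) + D))"
      using t by (simp add: m_def)
    also have "\<dots> \<ge> 4 / (sqrt (1 - t) * (4 * (1 - t) + 4 * D))"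
      using t q D by (intro divide_left_mono mult_left_mono mult_pos_pos) auto
    also have "4 / (sqrt (1 - t) * (4 * (1 - t) + 4 * D)) = 1 / (sqrt (1 - t) * ((1 - t) + D))"
      by (simp add: divide_simps)
    finally have "ennreal (1 / (sqrt (1 - t) * ((1 - t) + D))) \<le> ennreal (16 * (sqrt (1 - t) * m (2 * sqrt (1 - t))))"
      by (rule ennreal_leI)
    also have "\<dots> = ennreal 16 * ennreal (sqrt (1 - t) * m (2 * sqrt (1 - t)))"
      by (rule ennreal_mult) (use t D in \<open>auto simp: m_def\<close>)
    finally show "ennreal (1 / (sqrt (1 - t) * ((1 - t) + D))) \<le> ennreal 16 * ennreal (sqrt (1 - t) * m (2 * sqrt (1 - t)))" .
  qed
  also have "\<dots> = ennreal 16 * (\<integral>\<^sup>+t. ennreal (sqrt (1 - t) * m (2 * sqrt (1 - t))) \<partial>\<nu>)"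
    unfolding m_def by (intro nn_integral_cmult borel_measurable_borel_measure_01[OF \<nu>]) measurable
  also have "\<dots> \<le> ennreal 16 * (\<integral>\<^sup>+h. ennreal (m h) * indicator {0..} h * emeasure \<nu> {t \<in> space \<nu>. sqrt (1 - t) < h} \<partial>lborel)"
  proof (intro mult_left_mono nn_integral_le_layer_cake)
    show "(\<lambda>t. sqrt (1 - t)) \<in> borel_measurable \<nu>"
      by (intro borel_measurable_borel_measure_01[OF \<nu>]) auto
    show "m k \<le> m h" if "0 < h" "h \<le> k" for h k
      unfolding m_def using that D
      by (intro divide_left_mono mult_mono mult_pos_pos power_mono add_mono add_pos_pos) auto
  qed (auto simp: m_def sigma_finite_measure_axioms)
  also have "\<dots> \<le> ennreal 16 * (\<integral>\<^sup>+h. ennreal (C / (h\<^sup>2 + D)) * indicator {0..} h \<partial>lborel)"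
  proof (intro mult_left_mono nn_integral_mono)
    fix h :: real
    show "ennreal (m h) * indicator {0..} h * emeasure \<nu> {t \<in> space \<nu>. sqrt (1 - t) < h}
        \<le> ennreal (C / (h\<^sup>2 + D)) * indicator {0..} h"
    proof (cases "h > 0")
      case True
      have "emeasure \<nu> {t \<in> space \<nu>. sqrt (1 - t) < h} \<le> emeasure \<nu> {max 0 (1 - h\<^sup>2)..<1}"
      proof (rule emeasure_mono)
        show "{t \<in> space \<nu>. sqrt (1 - t) < h} \<subseteq> {max 0 (1 - h\<^sup>2)..<1}"
        proof
          fix t assume "t \<in> {t \<in> space \<nu>. sqrt (1 - t) < h}"
          then have "0 \<le> t" "t < 1" "sqrt (1 - t) < h" by auto
          moreover from this have "(sqrt (1 - t))\<^sup>2 \<le> h\<^sup>2"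
            by (intro power_mono) auto
          ultimately show "t \<in> {max 0 (1 - h\<^sup>2)..<1}" by auto
        qed
        show "{max 0 (1 - h\<^sup>2)..<1} \<in> sets \<nu>"
          using \<nu> by (auto simp: borel_measure_01_def sets_restrict_space_iff)
      qed
      also have "\<dots> \<le> ennreal (C * (1 - max 0 (1 - h\<^sup>2)))"
        using True by (intro carl) auto
      also have "\<dots> \<le> ennreal (C * h\<^sup>2)"
        using C by (intro ennreal_leI mult_left_mono) auto
      finally have "ennreal (m h) * emeasure \<nu> {t \<in> space \<nu>. sqrt (1 - t) < h} \<le> ennreal (m h) * ennreal (C * h\<^sup>2)"
        by (intro mult_left_mono) auto
      also have "\<dots> = ennreal (m h * (C * h\<^sup>2))"
        by (rule ennreal_mult[symmetric]) (use C D in \<open>auto simp: m_def\<close>)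
      also have "m h * (C * h\<^sup>2) = C / (h\<^sup>2 + D)"
        using True by (simp add: m_def)
      finally show ?thesis
        using True by simp
    next
      case False
      then show ?thesis by (cases "h = 0") (auto simp: m_def)
    qed
  qed simp
  also have "(\<integral>\<^sup>+h. ennreal (C / (h\<^sup>2 + D)) * indicator {0..} h \<partial>lborel)
      = ennreal (C / sqrt D * (pi / 2) - C / sqrt D * arctan (0 / sqrt D))"
  proof (rule nn_integral_FTC_atLeast)
    show "((\<lambda>h. C / sqrt D * arctan (h / sqrt D)) has_real_derivative C / (h\<^sup>2 + D)) (at h)" for h
    proof -
      have "((\<lambda>h. h / sqrt D) has_real_derivative 1 / sqrt D) (at h)"
        by (intro DERIV_cdivide DERIV_ident)
      from DERIV_cmult[OF DERIV_chain2[OF DERIV_arctan this], of "C / sqrt D"]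
      have "((\<lambda>h. C / sqrt D * arctan (h / sqrt D)) has_real_derivative
          C / sqrt D * (inverse (1 + (h / sqrt D)\<^sup>2) * (1 / sqrt D))) (at h)" .
      moreover have "C / sqrt D * (inverse (1 + (h / sqrt D)\<^sup>2) * (1 / sqrt D)) = C / (sqrt D * sqrt D * (1 + (h / sqrt D)\<^sup>2))"
        by (simp only: divide_inverse inverse_mult_distrib mult_ac mult_1_left)
      moreover have "(h / sqrt D)\<^sup>2 = h\<^sup>2 / D"
        using D by (simp add: power_divide)
      moreover have "sqrt D * sqrt D * (1 + h\<^sup>2 / D) = h\<^sup>2 + D"
        using D by (simp add: distrib_left)
      ultimately show ?thesis by (simp only:)
    qed
    have "filterlim (\<lambda>h. 1 / sqrt D * h) at_top at_top"
      using filterlim_tendsto_pos_mult_at_top[OF tendsto_const, of "1 / sqrt D" "\<lambda>h. h" at_top] D filterlim_ident[of at_top]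
      by simp
    then have "filterlim (\<lambda>h. h / sqrt D) at_top at_top"
      by simp
    then have "((\<lambda>h. arctan (h / sqrt D)) \<longlongrightarrow> pi / 2) at_top"
      by (rule filterlim_compose[OF tendsto_arctan_at_top])
    then show "((\<lambda>h. C / sqrt D * arctan (h / sqrt D)) \<longlongrightarrow> C / sqrt D * (pi / 2)) at_top"
      by (intro tendsto_mult tendsto_const)
  qed (use C D in \<open>auto intro!: divide_nonneg_nonneg\<close>)
  also have "ennreal 16 * \<dots> = ennreal (16 * (C / sqrt D * (pi / 2) - C / sqrt D * arctan (0 / sqrt D)))"
    using C D by (intro ennreal_mult[symmetric]) auto
  also have "16 * (C / sqrt D * (pi / 2) - C / sqrt D * arctan (0 / sqrt D)) = 8 * pi * C / sqrt D"
    by simp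
  finally show ?thesis .
qed

section \<open>Cauchy transforms and disc automorphisms\<close>

text \<open>Expanding the kernel into a geometric series and integrating term by term gives a power series.\<close>

lemma holomorphic_on_cauchy_transform:
  fixes u b :: "'a \<Rightarrow> complex"
  assumes u: "integrable M u" and b[measurable]: "b \<in> borel_measurable M"
    and b1: "\<And>x. x \<in> space M \<Longrightarrow> cmod (b x) \<le> 1"
  shows "(\<lambda>z. \<integral>x. u x / (1 - b x * z) \<partial>M) holomorphic_on unit_disc"
proof (rule power_series_holomorphic)
  fix z :: complex assume "z \<in> unit_disc"
  then have z: "cmod z < 1" by simp
  have [measurable]: "u \<in> borel_measurable M" using u by auto
  have bz: "cmod (b x * z) < 1" if "x \<in> space M" for x
    using b1[OF that] z mult_left_le_one_le[of "cmod z" "cmod (b x)"] by (simp add: norm_mult)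
  have bn: "cmod (u x * b x ^ n) \<le> cmod (u x)" if "x \<in> space M" for x n
    using b1[OF that] by (auto simp: norm_mult norm_power intro!: mult_left_le power_le_one)
  have int: "integrable M (\<lambda>x. u x * b x ^ n)" for n
    by (rule Bochner_Integration.integrable_bound[OF u]) (use bn in auto)
  have "(\<lambda>n. \<integral>x. u x * b x ^ n * z ^ n \<partial>M) sums (\<integral>x. (\<Sum>n. u x * b x ^ n * z ^ n) \<partial>M)"
  proof (rule sums_integral)
    show "integrable M (\<lambda>x. u x * b x ^ n * z ^ n)" for n
      using int by (rule integrable_mult_left)
    show "AE x in M. summable (\<lambda>n. norm (u x * b x ^ n * z ^ n))"
    proof (rule AE_I2)
      fix x assume "x \<in> space M"
      from bz[OF this] have "summable (\<lambda>n. norm (u x) * norm (b x * z) ^ n)"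
        by (intro summable_mult summable_geometric) auto
      then show "summable (\<lambda>n. norm (u x * b x ^ n * z ^ n))"
        by (simp add: norm_mult norm_power power_mult_distrib mult.assoc)
    qed
    have "summable (\<lambda>n. (\<integral>x. norm (u x) \<partial>M) * cmod z ^ n)"
      using z by (intro summable_mult summable_geometric) auto
    then show "summable (\<lambda>n. \<integral>x. norm (u x * b x ^ n * z ^ n) \<partial>M)"
    proof (rule summable_comparison_test'[where N = 0])
      fix n :: nat
      have "(\<integral>x. norm (u x * b x ^ n * z ^ n) \<partial>M) = (\<integral>x. norm (u x * b x ^ n) \<partial>M) * cmod z ^ n"
        by (simp add: norm_mult norm_power)
      also have "\<dots> \<le> (\<integral>x. norm (u x) \<partial>M) * cmod z ^ n"
        by (intro mult_right_mono integral_mono integrable_norm int u bn) auto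
      finally show "norm (\<integral>x. norm (u x * b x ^ n * z ^ n) \<partial>M) \<le> (\<integral>x. norm (u x) \<partial>M) * cmod z ^ n"
        by simp
    qed
  qed
  also have "(\<integral>x. (\<Sum>n. u x * b x ^ n * z ^ n) \<partial>M) = (\<integral>x. u x / (1 - b x * z) \<partial>M)"
  proof (rule Bochner_Integration.integral_cong[OF refl])
    fix x assume "x \<in> space M"
    from bz[OF this] have "(\<lambda>n. u x * (b x * z) ^ n) sums (u x * (1 / (1 - b x * z)))"
      by (intro sums_mult geometric_sums)
    then show "(\<Sum>n. u x * b x ^ n * z ^ n) = u x / (1 - b x * z)"
      by (simp add: power_mult_distrib mult.assoc sums_iff)
  qed
  finally show "(\<lambda>n. (\<integral>x. u x * b x ^ n \<partial>M) * (z - 0) ^ n) sums (\<integral>x. u x / (1 - b x * z) \<partial>M)"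
    by simp
qed

lemma integrable_cauchy_kernel:
  fixes u b :: "'a \<Rightarrow> complex"
  assumes u: "integrable M u" and b[measurable]: "b \<in> borel_measurable M"
    and b1: "\<And>x. x \<in> space M \<Longrightarrow> cmod (b x) \<le> 1" and z: "cmod z < 1"
  shows "integrable M (\<lambda>x. u x / (1 - b x * z))"
proof (rule Bochner_Integration.integrable_bound[OF integrable_mult_left[OF u]])
  have [measurable]: "u \<in> borel_measurable M" using u by auto
  show "(\<lambda>x. u x / (1 - b x * z)) \<in> borel_measurable M" by measurable
  show "AE x in M. norm (u x / (1 - b x * z)) \<le> norm (u x * of_real (1 / (1 - cmod z)))"
  proof (rule AE_I2)
    fix x assume x: "x \<in> space M"
    have "1 - cmod z \<le> 1 - cmod (b x * z)"
      using b1[OF x] by (simp add: norm_mult mult_left_le_one_le)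
    also have "\<dots> \<le> cmod (1 - b x * z)"
      using norm_triangle_ineq2[of 1 "b x * z"] by simp
    finally have "cmod (u x) / cmod (1 - b x * z) \<le> cmod (u x) / (1 - cmod z)"
      using z by (intro divide_left_mono mult_pos_pos) auto
    then show "norm (u x / (1 - b x * z)) \<le> norm (u x * of_real (1 / (1 - cmod z)))"
      using z by (simp only: norm_divide norm_mult norm_of_real) simp
  qed
qed

text \<open>This is the image of \<open>t\<close> under the automorphism \<open>disc_aut (cnj a)\<close>. It occurs as the parameter of the Cauchy
  kernel that arises from \<open>1 / (1 - t z)\<close> by composition with \<open>disc_aut a\<close>.\<close>

definition mobius_coeff :: "complex \<Rightarrow> real \<Rightarrow> complex" where
  "mobius_coeff a t = (cnj a - of_real t) / (1 - of_real t * a)"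

lemma one_minus_real_mult_nonzero:
  assumes "cmod a < 1" "0 \<le> t" "t < 1"
  shows "1 - of_real t * a \<noteq> 0"
proof
  assume "1 - of_real t * a = 0"
  then have "cmod (of_real t * a) = 1" by simp
  moreover have "cmod (of_real t * a) \<le> cmod a"
    using assms mult_left_le_one_le[of "cmod a" t] by (simp add: norm_mult)
  ultimately show False using assms by simp
qed

lemma one_minus_cmod_mobius_coeff:
  assumes a: "cmod a < 1" and t: "0 \<le> t" "t < 1"
  shows "1 - (cmod (mobius_coeff a t))\<^sup>2 = (1 - t\<^sup>2) * (1 - (cmod a)\<^sup>2) / (cmod (1 - of_real t * a))\<^sup>2"
proof -
  have "(cmod (1 - of_real t * a))\<^sup>2 - (cmod (cnj a - of_real t))\<^sup>2 = (1 - t\<^sup>2) * (1 - (cmod a)\<^sup>2)"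
    using cmod_one_minus_cnj_mult[of "cnj a" "of_real t"] by (simp add: mult.commute norm_minus_commute)
  then show ?thesis
    using one_minus_real_mult_nonzero[OF assms]
    by (simp add: mobius_coeff_def norm_divide power_divide field_simps)
qed

lemma cmod_mobius_coeff_less_1:
  assumes a: "cmod a < 1" and t: "0 \<le> t" "t < 1"
  shows "cmod (mobius_coeff a t) < 1"
proof -
  have "0 < (1 - t\<^sup>2) * (1 - (cmod a)\<^sup>2) / (cmod (1 - of_real t * a))\<^sup>2"
    using one_minus_real_mult_nonzero[OF assms] assms
    by (intro divide_pos_pos mult_pos_pos) (auto simp: power_less_one_iff)
  then have "(cmod (mobius_coeff a t))\<^sup>2 < 1\<^sup>2"
    unfolding one_minus_cmod_mobius_coeff[OF assms, symmetric] by simp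
  then show ?thesis
    by (rule power2_less_imp_less) simp
qed

lemma disc_aut_in_disc:
  assumes "cmod a < 1" "cmod z < 1"
  shows "cmod (disc_aut a z) < 1"
  using one_minus_cnj_mult_lower(1)[OF assms]
  by (simp add: disc_aut_def norm_divide norm_minus_commute divide_less_eq)

text \<open>With \<open>p = 1 - t a\<close>, \<open>q = 1 - cnj a z\<close> and \<open>r = p - (cnj a - t) z\<close> one has
  \<open>1 - t (disc_aut a z) = r / q\<close> and \<open>1 - mobius_coeff a t * z = r / p\<close>, and the claim becomes
  the polynomial identity \<open>q p - r = - z (1 - \<bar>a\<bar>\<^sup>2) t\<close>.\<close>

lemma cauchy_kernel_disc_aut:
  assumes a: "cmod a < 1" and z: "cmod z < 1" and t: "0 \<le> t" "t < 1"
  shows "1 / (1 - of_real t * disc_aut a z) - 1 / (1 - of_real t * a)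
    = - z * of_real (1 - (cmod a)\<^sup>2) * (of_real t / (1 - of_real t * a)\<^sup>2 / (1 - mobius_coeff a t * z))"
proof -
  define p q where "p = 1 - of_real t * a" and "q = 1 - cnj a * z"
  have p: "p \<noteq> 0" using one_minus_real_mult_nonzero[OF a t] by (simp add: p_def)
  have q: "q \<noteq> 0" using one_minus_cnj_mult_lower(2)[OF a z] a by (auto simp: q_def)
  define e where "e = cnj a - of_real t"
  define r where "r = p - e * z"
  have 2: "1 - mobius_coeff a t * z = r / p"
    using p by (simp add: mobius_coeff_def r_def flip: e_def p_def) (simp add: diff_divide_distrib)
  have r: "r \<noteq> 0"
  proof -
    have "cmod (mobius_coeff a t * z) < 1"
      using cmod_mobius_coeff_less_1[OF a t] z mult_left_le_one_le[of "cmod z" "cmod (mobius_coeff a t)"]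
      by (simp add: norm_mult)
    then have "1 - mobius_coeff a t * z \<noteq> 0" by auto
    with 2 show ?thesis by auto
  qed
  have "q - of_real t * (a - z) = r"
    by (simp add: q_def r_def p_def e_def algebra_simps)
  moreover have "1 - of_real t * disc_aut a z = (q - of_real t * (a - z)) / q"
    unfolding disc_aut_def q_def[symmetric]
    using q by (simp only: diff_divide_distrib[of q "of_real t * (a - z)" q] right_inverse_eq times_divide_eq_right divide_self_if if_False)
  ultimately have 1: "1 - of_real t * disc_aut a z = r / q"
    by simp
  have 3: "q * p - r = - z * of_real (1 - (cmod a)\<^sup>2) * of_real t"
    unfolding of_real_diff complex_norm_square by (simp add: q_def r_def p_def e_def algebra_simps)
  have "1 / (r / q) - 1 / p = (q * p - r) / (r * p)"
    using p q r by (simp add: diff_divide_distrib)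
  also have "\<dots> = - z * of_real (1 - (cmod a)\<^sup>2) * (of_real t / p\<^sup>2 / (r / p))"
    unfolding 3 using p r by (simp add: power2_eq_square)
  finally show ?thesis
    unfolding 1 2 by (simp add: p_def)
qed

lemma borel_measurable_of_real_borel_measure_01:
  assumes "borel_measure_01 \<nu>"
  shows "complex_of_real \<in> borel_measurable \<nu>"
  by (rule borel_measurable_borel_measure_01[OF assms]) simp

lemma cauchy_transform_disc_aut:
  assumes \<nu>: "borel_measure_01 \<nu>" and u: "integrable \<nu> u" and a: "cmod a < 1" and z: "cmod z < 1"
  defines "F \<equiv> \<lambda>z. \<integral>t. u t / (1 - of_real t * z) \<partial>\<nu>"
    and "w \<equiv> \<lambda>t. u t * of_real t / (1 - of_real t * a)\<^sup>2"
  shows "integrable \<nu> w" "mobius_coeff a \<in> borel_measurable \<nu>"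
    and "integrable \<nu> (\<lambda>t. w t / (1 - mobius_coeff a t * z))"
    and "F (disc_aut a z) - F a = - z * of_real (1 - (cmod a)\<^sup>2) * (\<integral>t. w t / (1 - mobius_coeff a t * z) \<partial>\<nu>)"
proof -
  note [measurable] = borel_measurable_of_real_borel_measure_01[OF \<nu>]
  note space[simp] = space_borel_measure_01[OF \<nu>]
  have [measurable]: "u \<in> borel_measurable \<nu>" using u by auto
  show m: "mobius_coeff a \<in> borel_measurable \<nu>"
    unfolding mobius_coeff_def by measurable
  have t1: "cmod (of_real t) \<le> 1" if "t \<in> space \<nu>" for t
    using that by auto
  have int: "integrable \<nu> (\<lambda>t. u t / (1 - of_real t * x))" if "cmod x < 1" for x
    by (rule integrable_cauchy_kernel[OF u _ t1 that]) measurable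
  show w: "integrable \<nu> w"
  proof -
    \<comment> \<open>The factor \<open>(1 - t a)\<^sup>2\<close> in the denominator is reached by dividing by the Cauchy kernel twice.\<close>
    have "integrable \<nu> (\<lambda>t. u t / (1 - of_real t * a) / (1 - of_real t * a))"
      by (rule integrable_cauchy_kernel[OF int[OF a] _ t1 a]) measurable
    then show ?thesis
      by (rule Bochner_Integration.integrable_bound)
         (auto simp: w_def norm_mult norm_divide power2_eq_square intro!: divide_right_mono mult_left_le AE_I2)
  qed
  show wi: "integrable \<nu> (\<lambda>t. w t / (1 - mobius_coeff a t * z))"
    by (rule integrable_cauchy_kernel[OF w m _ z]) (use cmod_mobius_coeff_less_1[OF a] in \<open>auto intro: less_imp_le\<close>)
  have "F (disc_aut a z) - F a = (\<integral>t. u t / (1 - of_real t * disc_aut a z) - u t / (1 - of_real t * a) \<partial>\<nu>)"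
    unfolding F_def by (rule Bochner_Integration.integral_diff[symmetric]) (intro int disc_aut_in_disc a z)+
  also have "\<dots> = (\<integral>t. - z * of_real (1 - (cmod a)\<^sup>2) * (w t / (1 - mobius_coeff a t * z)) \<partial>\<nu>)"
  proof (rule Bochner_Integration.integral_cong[OF refl])
    fix t assume "t \<in> space \<nu>"
    then have t: "0 \<le> t" "t < 1" by auto
    have "u t / (1 - of_real t * disc_aut a z) - u t / (1 - of_real t * a)
       = u t * (1 / (1 - of_real t * disc_aut a z) - 1 / (1 - of_real t * a))"
      by (simp add: algebra_simps)
    also have "\<dots> = - z * of_real (1 - (cmod a)\<^sup>2) * (w t / (1 - mobius_coeff a t * z))"
      unfolding cauchy_kernel_disc_aut[OF a z t] by (simp add: w_def)
    finally show "u t / (1 - of_real t * disc_aut a z) - u t / (1 - of_real t * a)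
       = - z * of_real (1 - (cmod a)\<^sup>2) * (w t / (1 - mobius_coeff a t * z))" .
  qed
  also have "\<dots> = - z * of_real (1 - (cmod a)\<^sup>2) * (\<integral>t. w t / (1 - mobius_coeff a t * z) \<partial>\<nu>)"
    by (rule integral_mult_right_zero)
  finally show "F (disc_aut a z) - F a = - z * of_real (1 - (cmod a)\<^sup>2) * (\<integral>t. w t / (1 - mobius_coeff a t * z) \<partial>\<nu>)" .
qed

section \<open>Cauchy transforms of Carleson measures are in BMOA\<close>

text \<open>The Poisson kernel \<open>(1 - \<bar>z\<bar>\<^sup>2) / \<bar>1 - z\<bar>\<^sup>2\<close> is the real part of the holomorphic function
  \<open>(1 + z) / (1 - z)\<close>, which has the value \<open>1\<close> at \<open>0\<close>. Up to the factor \<open>2 pi\<close> this is the square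
  of the \<open>H\<^sup>2\<close> norm of a Cauchy kernel.\<close>

lemma nn_integral_Poisson_kernel:
  assumes c: "cmod c < 1"
  shows "(\<integral>\<^sup>+\<theta>\<in>{0..2*pi}. ennreal (1 / (cmod (1 - c * cis \<theta>))\<^sup>2) \<partial>lborel) = ennreal (2 * pi / (1 - (cmod c)\<^sup>2))"
proof -
  have pos: "1 - (cmod c)\<^sup>2 > 0"
    using c by (simp add: power_less_one_iff)
  have "((\<lambda>\<theta>. (1 + (0 + c * cis \<theta>)) / (1 - (0 + c * cis \<theta>))) has_integral 2 * of_real pi * ((1 + 0) / (1 - 0))) {0..2*pi}"
    by (rule circle_mean_value[of "\<lambda>z. (1 + z) / (1 - z)" 0 1]) (use c in \<open>auto intro!: holomorphic_intros\<close>)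
  from has_integral_Re[OF this]
  have "((\<lambda>\<theta>. Re ((1 + c * cis \<theta>) / (1 - c * cis \<theta>))) has_integral 2 * pi) {0..2*pi}"
    by simp
  moreover have "Re ((1 + c * cis \<theta>) / (1 - c * cis \<theta>)) = (1 - (cmod c)\<^sup>2) * (1 / (cmod (1 - c * cis \<theta>))\<^sup>2)" for \<theta>
  proof -
    have "Re ((1 + z) / (1 - z)) = (1 - (cmod z)\<^sup>2) / (cmod (1 - z))\<^sup>2" for z
      by (simp add: Re_divide cmod_power2) (simp add: power2_eq_square algebra_simps)
    from this[of "c * cis \<theta>"] show ?thesis by (simp add: norm_mult)
  qed
  ultimately have "((\<lambda>\<theta>. (1 - (cmod c)\<^sup>2) * (1 / (cmod (1 - c * cis \<theta>))\<^sup>2)) has_integral 2 * pi) {0..2*pi}"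
    by simp
  from has_integral_mult_right[OF this, of "1 / (1 - (cmod c)\<^sup>2)"] pos
  have "((\<lambda>\<theta>. 1 / (cmod (1 - c * cis \<theta>))\<^sup>2) has_integral (2 * pi / (1 - (cmod c)\<^sup>2))) {0..2*pi}"
    by simp
  from nn_integral_has_integral_lebesgue'[OF _ this] show ?thesis
    by simp
qed

text \<open>Fix \<open>a\<close>. By \<open>cauchy_transform_disc_aut\<close> the function whose \<open>H\<^sup>2\<close> norm is sought is an integral of Cauchy
  kernels; Minkowski's inequality bounds its norm by the integral of \<open>w\<close>, the norms of these kernels. Since
  \<open>\<bar>1 - t a\<bar>\<close> is comparable to \<open>(1 - t) + \<bar>1 - a\<bar>\<close>, the integral of \<open>w\<close> is at most a multiple of
  \<open>sqrt (1 - \<bar>a\<bar>)\<close> times the integral in \<open>carleson_nn_integral_bound\<close> with \<open>D = \<bar>1 - a\<bar>\<close>, and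
  \<open>1 - \<bar>a\<bar> \<le> D\<close> makes the bound uniform in \<open>a\<close>.\<close>

lemma carleson_cauchy_transform_BMOA:
  assumes \<nu>: "borel_measure_01 \<nu>" and C: "C \<ge> 0" and K: "K \<ge> 0"
    and carl: "\<And>t. 0 \<le> t \<Longrightarrow> t < 1 \<Longrightarrow> emeasure \<nu> {t..<1} \<le> ennreal (C * (1 - t))"
    and v: "v \<in> borel_measurable \<nu>" "\<And>t. 0 \<le> t \<Longrightarrow> t < 1 \<Longrightarrow> cmod (v t) \<le> K"
  defines "F \<equiv> \<lambda>z. \<integral>t. v t / (1 - of_real t * z) \<partial>\<nu>"
  shows "F holomorphic_on unit_disc"
    and "BMOA_norm F \<le> ennreal ((1 + 32 * sqrt 2 * pi) * C * K)"
proof -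
  note space[simp] = space_borel_measure_01[OF \<nu>]
  note [measurable] = borel_measurable_of_real_borel_measure_01[OF \<nu>] v(1)
  have mass: "emeasure \<nu> (space \<nu>) \<le> ennreal C"
    using carl[of 0] by simp
  then have fin: "finite_measure \<nu>"
    by (intro finite_measureI) (auto simp: top_unique)
  then interpret finite_measure \<nu> .
  have u: "integrable \<nu> v"
    by (rule integrable_const_bound[where B = K]) (use v in auto)
  show "F holomorphic_on unit_disc"
    unfolding F_def by (rule holomorphic_on_cauchy_transform[OF u]) auto
  have F0: "ennreal (cmod (F 0)) \<le> ennreal (C * K)"
  proof -
    have "ennreal (cmod (F 0)) \<le> (\<integral>\<^sup>+t. norm (v t) \<partial>\<nu>)"
      unfolding F_def using integral_norm_bound_ennreal[OF u] by simp
    also have "\<dots> \<le> (\<integral>\<^sup>+t. ennreal K \<partial>\<nu>)"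
      using v by (intro nn_integral_mono ennreal_leI) auto
    also have "\<dots> \<le> ennreal K * ennreal C"
      using mass by (auto intro: mult_left_mono)
    finally show ?thesis using K C by (simp add: mult.commute flip: ennreal_mult)
  qed
  have H2: "H2_norm (\<lambda>z. F (disc_aut a z) - F a) \<le> ennreal (32 * sqrt 2 * pi * C * K)"
    if "a \<in> unit_disc" for a
  proof -
    from that have a: "cmod a < 1" by simp
    define d D where "d = 1 - cmod a" and "D = cmod (1 - a)"
    have d: "0 < d" "d \<le> D"
      using a norm_triangle_ineq2[of 1 a] by (auto simp: d_def D_def)
    \<comment> \<open>The \<open>L\<^sup>2\<close> norm over \<open>[0, 2 pi]\<close> of the kernel \<open>k t\<close> below for \<open>r = 1\<close>; for smaller \<open>r\<close> the norm is smaller.\<close>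
    define w where "w t = sqrt (2 * pi) * (sqrt (1 - (cmod a)\<^sup>2) / (cmod (1 - of_real t * a) * sqrt (1 - t\<^sup>2)))" for t :: real
    have a2: "0 < 1 - (cmod a)\<^sup>2" "1 - (cmod a)\<^sup>2 \<le> 2 * d"
    proof -
      have "1 - (cmod a)\<^sup>2 = (1 + cmod a) * d"
        by (simp add: d_def power2_eq_square algebra_simps)
      then show "0 < 1 - (cmod a)\<^sup>2" "1 - (cmod a)\<^sup>2 \<le> 2 * d"
        using a d by (auto simp: intro!: mult_right_mono mult_pos_pos add_pos_nonneg)
    qed
    have pos: "0 < cmod (1 - of_real t * a)" "0 < 1 - t\<^sup>2" if "0 \<le> t" "t < 1" for t
      using one_minus_real_mult_nonzero[OF a that] that by (auto simp: power_less_one_iff)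
    have w0: "w t > 0" if "t \<in> space \<nu>" for t
      using that pos[of t] a2 by (auto simp: w_def)
    have w_int: "(\<integral>\<^sup>+t. ennreal (w t) \<partial>\<nu>) \<le> ennreal (sqrt (2 * pi) * (32 * sqrt 2 * pi * C))"
    proof -
      have "(\<integral>\<^sup>+t. ennreal (w t) \<partial>\<nu>)
          \<le> (\<integral>\<^sup>+t. ennreal (sqrt (2 * pi) * (4 * sqrt 2 * sqrt d)) * ennreal (1 / (sqrt (1 - t) * ((1 - t) + D))) \<partial>\<nu>)"
      proof (rule nn_integral_mono)
        fix t assume "t \<in> space \<nu>"
        then have t: "0 \<le> t" "t < 1" by auto
        have "1 - t \<le> cmod (1 - of_real t * a)"
          using norm_triangle_ineq2[of 1 "of_real t * a"] mult_left_le[of "cmod a" t] a t by (simp add: norm_mult)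
        moreover have "D \<le> cmod (1 - of_real t * a) + (1 - t)"
        proof -
          have "1 - a = (1 - of_real t * a) - of_real (1 - t) * a"
            by (simp add: algebra_simps)
          then have "D \<le> cmod (1 - of_real t * a) + cmod (of_real (1 - t) * a)"
            unfolding D_def by (metis norm_triangle_ineq4)
          also have "cmod (of_real (1 - t) * a) \<le> 1 - t"
            using a t by (simp only: norm_mult norm_of_real) (simp add: mult_left_le)
          finally show ?thesis by simp
        qed
        ultimately have low: "((1 - t) + D) / 4 \<le> cmod (1 - of_real t * a)"
          using d t by (simp add: field_simps)
        have "1 - t \<le> 1 - t\<^sup>2"
          using t mult_left_le[of t t] by (simp add: power2_eq_square)
        then have "sqrt (1 - (cmod a)\<^sup>2) / (cmod (1 - of_real t * a) * sqrt (1 - t\<^sup>2))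
            \<le> sqrt (2 * d) / (((1 - t) + D) / 4 * sqrt (1 - t))"
          using d t a2 pos[OF t] low by (intro frac_le mult_mono) auto
        also have "\<dots> = 4 * sqrt 2 * sqrt d * (1 / (sqrt (1 - t) * ((1 - t) + D)))"
          by (simp add: real_sqrt_mult mult.commute)
        finally have "w t \<le> sqrt (2 * pi) * (4 * sqrt 2 * sqrt d * (1 / (sqrt (1 - t) * ((1 - t) + D))))"
          unfolding w_def by (intro mult_left_mono) auto
        also have "\<dots> = sqrt (2 * pi) * (4 * sqrt 2 * sqrt d) * (1 / (sqrt (1 - t) * ((1 - t) + D)))"
          by (simp only: mult.assoc)
        finally show "ennreal (w t) \<le> ennreal (sqrt (2 * pi) * (4 * sqrt 2 * sqrt d)) * ennreal (1 / (sqrt (1 - t) * ((1 - t) + D)))"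
          using d t by (subst ennreal_mult[symmetric]) (auto intro!: ennreal_leI)
      qed
      also have "\<dots> = ennreal (sqrt (2 * pi) * (4 * sqrt 2 * sqrt d)) * (\<integral>\<^sup>+t. ennreal (1 / (sqrt (1 - t) * ((1 - t) + D))) \<partial>\<nu>)"
        by (intro nn_integral_cmult borel_measurable_borel_measure_01[OF \<nu>]) auto
      also have "\<dots> \<le> ennreal (sqrt (2 * pi) * (4 * sqrt 2 * sqrt d)) * ennreal (8 * pi * C / sqrt D)"
        using d by (intro mult_left_mono carleson_nn_integral_bound[OF \<nu> C _ carl]) auto
      also have "\<dots> = ennreal (sqrt (2 * pi) * (4 * sqrt 2 * sqrt d) * (8 * pi * C / sqrt D))"
        using d C by (intro ennreal_mult[symmetric]) auto
      also have "\<dots> \<le> ennreal (sqrt (2 * pi) * (32 * sqrt 2 * pi * C))"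
      proof (rule ennreal_leI)
        have "sqrt d / sqrt D \<le> 1"
          using d by (simp add: divide_le_eq)
        then have "sqrt (2 * pi) * (32 * sqrt 2 * pi * C) * (sqrt d / sqrt D) \<le> sqrt (2 * pi) * (32 * sqrt 2 * pi * C) * 1"
          using C by (intro mult_left_mono) auto
        then show "sqrt (2 * pi) * (4 * sqrt 2 * sqrt d) * (8 * pi * C / sqrt D) \<le> sqrt (2 * pi) * (32 * sqrt 2 * pi * C)"
          by (simp add: mult_ac)
      qed
      finally show ?thesis .
    qed
    show ?thesis
      unfolding H2_norm_def
    proof (rule SUP_least)
      fix r :: real assume "r \<in> {0..<1}"
      then have r: "0 \<le> r" "r < 1" by auto
      \<comment> \<open>The modulus of the kernel on the circle of radius \<open>r\<close>, without the factors \<open>v t\<close>, \<open>t\<close> and \<open>z\<close> of modulus at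
      most \<open>K\<close>, \<open>1\<close> and \<open>1\<close>.\<close>
      define k where "k t \<theta> = (1 - (cmod a)\<^sup>2) / (cmod (1 - of_real t * a))\<^sup>2 * (1 / cmod (1 - mobius_coeff a t * (of_real r * cis \<theta>)))" for t \<theta> :: real
      let ?N = "restrict_space lborel {0..2*pi}"
      have "mobius_coeff a \<in> borel_measurable \<nu>"
        by (rule cauchy_transform_disc_aut(2)[OF \<nu> u a, of 0]) simp
      note [measurable] = this
      have [measurable]: "cis \<in> borel_measurable ?N"
        by (intro measurable_restrict_space1) (simp, intro borel_measurable_continuous_onI continuous_intros)
      have sN: "sigma_finite_measure ?N"
        by (rule sigma_finite_measure_restrict_space) (auto simp: lborel.sigma_finite_measure_axioms)
      have mink: "(\<integral>\<^sup>+\<theta>. (\<integral>\<^sup>+t. ennreal (k t \<theta>) \<partial>\<nu>)\<^sup>2 \<partial>?N) \<le> (\<integral>\<^sup>+t. ennreal (w t) \<partial>\<nu>)\<^sup>2"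
      proof (rule nn_integral_Minkowski_L2[OF sigma_finite_measure_axioms sN])
        show "case_prod k \<in> borel_measurable (\<nu> \<Otimes>\<^sub>M ?N)"
          unfolding k_def by measurable
        show "w \<in> borel_measurable \<nu>"
          unfolding w_def by (rule borel_measurable_borel_measure_01[OF \<nu>]) measurable
        show "0 < w t" if "t \<in> space \<nu>" for t by (rule w0[OF that])
        show "0 \<le> k t \<theta>" for t \<theta> using a2 by (auto simp: k_def)
        show "(\<integral>\<^sup>+\<theta>. ennreal ((k t \<theta>)\<^sup>2) \<partial>?N) \<le> ennreal ((w t)\<^sup>2)" if "t \<in> space \<nu>" for t
        proof -
          from that have t: "0 \<le> t" "t < 1" by auto
          let ?b = "mobius_coeff a t" and ?c = "(1 - (cmod a)\<^sup>2) / (cmod (1 - of_real t * a))\<^sup>2"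
          have b: "cmod ?b < 1" by (rule cmod_mobius_coeff_less_1[OF a t])
          have br: "cmod (?b * of_real r) \<le> cmod ?b"
            using r by (simp add: norm_mult mult_left_le)
          have "(\<integral>\<^sup>+\<theta>. ennreal ((k t \<theta>)\<^sup>2) \<partial>?N) = (\<integral>\<^sup>+\<theta>\<in>{0..2*pi}. ennreal ((k t \<theta>)\<^sup>2) \<partial>lborel)"
            by (simp add: nn_integral_restrict_space)
          also have "\<dots> = (\<integral>\<^sup>+\<theta>. ennreal (?c\<^sup>2) * (ennreal (1 / (cmod (1 - (?b * of_real r) * cis \<theta>))\<^sup>2) * indicator {0..2*pi} \<theta>) \<partial>lborel)"
            by (intro nn_integral_cong)
               (auto simp: k_def power_mult_distrib power_divide mult.assoc split: split_indicator simp flip: ennreal_mult)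
          also have "\<dots> = ennreal (?c\<^sup>2) * (\<integral>\<^sup>+\<theta>\<in>{0..2*pi}. ennreal (1 / (cmod (1 - (?b * of_real r) * cis \<theta>))\<^sup>2) \<partial>lborel)"
          proof (rule nn_integral_cmult)
            have [measurable]: "cis \<in> borel_measurable borel"
              by (intro borel_measurable_continuous_onI continuous_intros)
            show "(\<lambda>\<theta>. ennreal (1 / (cmod (1 - (?b * of_real r) * cis \<theta>))\<^sup>2) * indicator {0..2*pi} \<theta>) \<in> borel_measurable lborel"
              by measurable
          qed
          also have "\<dots> = ennreal (?c\<^sup>2 * (2 * pi / (1 - (cmod (?b * of_real r))\<^sup>2)))"
          proof -
            have lt: "cmod (?b * of_real r) < 1" using b br by linarith
            then have "0 \<le> 2 * pi / (1 - (cmod (?b * of_real r))\<^sup>2)"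
              by (intro divide_nonneg_nonneg) (auto simp: power_le_one simp del: norm_mult)
            then show ?thesis
              unfolding nn_integral_Poisson_kernel[OF lt] by (intro ennreal_mult[symmetric]) auto
          qed
          also have "\<dots> \<le> ennreal (?c\<^sup>2 * (2 * pi / (1 - (cmod ?b)\<^sup>2)))"
          proof (intro ennreal_leI mult_left_mono divide_left_mono mult_pos_pos)
            show "1 - (cmod ?b)\<^sup>2 \<le> 1 - (cmod (?b * of_real r))\<^sup>2"
              using br by (simp add: power_mono)
            show "0 < 1 - (cmod ?b)\<^sup>2"
              using b by (simp add: power_less_one_iff)
            then show "0 < 1 - (cmod (?b * of_real r))\<^sup>2"
              using \<open>1 - (cmod ?b)\<^sup>2 \<le> 1 - (cmod (?b * of_real r))\<^sup>2\<close> by linarith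
          qed auto
          also have "?c\<^sup>2 * (2 * pi / (1 - (cmod ?b)\<^sup>2)) = (w t)\<^sup>2"
          proof -
            have alg: "(A / p\<^sup>2)\<^sup>2 * (2 * pi / (T * A / p\<^sup>2)) = (sqrt (2 * pi) * (sqrt A / (p * sqrt T)))\<^sup>2"
              if "A > 0" "p > 0" "T > 0" for A p T :: real
              using that by (simp add: power_mult_distrib power_divide field_simps) (simp add: power2_eq_square)
            show ?thesis
              unfolding one_minus_cmod_mobius_coeff[OF a t] w_def
              by (rule alg[OF a2(1) pos[OF t]])
          qed
          finally show ?thesis .
        qed
      qed
      have ptw: "ennreal ((cmod (F (disc_aut a (of_real r * cis \<theta>)) - F a))\<^sup>2)
          \<le> (ennreal K)\<^sup>2 * (\<integral>\<^sup>+t. ennreal (k t \<theta>) \<partial>\<nu>)\<^sup>2" for \<theta>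
      proof -
        let ?z = "of_real r * cis \<theta>"
        have z: "cmod ?z < 1" using r by (simp add: norm_mult)
        note tr = cauchy_transform_disc_aut[OF \<nu> u a z]
        let ?g = "\<lambda>t. v t * of_real t / (1 - of_real t * a)\<^sup>2 / (1 - mobius_coeff a t * ?z)"
        have "cmod (F (disc_aut a ?z) - F a) \<le> (1 - (cmod a)\<^sup>2) * cmod (\<integral>t. ?g t \<partial>\<nu>)"
        proof -
          have "cmod (F (disc_aut a ?z) - F a) = cmod ?z * (1 - (cmod a)\<^sup>2) * cmod (\<integral>t. ?g t \<partial>\<nu>)"
            unfolding F_def tr(4) norm_mult norm_minus_cancel norm_of_real using a2 by simp
          also have "\<dots> \<le> 1 * (1 - (cmod a)\<^sup>2) * cmod (\<integral>t. ?g t \<partial>\<nu>)"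
            using z a2 by (intro mult_right_mono) auto
          finally show ?thesis by simp
        qed
        then have "ennreal (cmod (F (disc_aut a ?z) - F a)) \<le> ennreal (1 - (cmod a)\<^sup>2) * ennreal (cmod (\<integral>t. ?g t \<partial>\<nu>))"
          using a2 by (simp add: ennreal_leI flip: ennreal_mult)
        also have "\<dots> \<le> ennreal (1 - (cmod a)\<^sup>2) * (\<integral>\<^sup>+t. norm (?g t) \<partial>\<nu>)"
          by (intro mult_left_mono integral_norm_bound_ennreal tr(3)) auto
        also have "\<dots> = (\<integral>\<^sup>+t. ennreal (1 - (cmod a)\<^sup>2) * norm (?g t) \<partial>\<nu>)"
          using borel_measurable_integrable[OF tr(3)] by (intro nn_integral_cmult[symmetric]) measurable
        also have "\<dots> \<le> (\<integral>\<^sup>+t. ennreal K * ennreal (k t \<theta>) \<partial>\<nu>)"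
        proof (rule nn_integral_mono)
          fix t assume "t \<in> space \<nu>"
          then have t: "0 \<le> t" "t < 1" by auto
          have "(1 - (cmod a)\<^sup>2) * norm (?g t) = (cmod (v t) * t) * k t \<theta>"
            using t by (simp add: k_def norm_mult norm_divide norm_power)
          also have "\<dots> \<le> (K * 1) * k t \<theta>"
            using t v(2)[OF t] K a2 by (intro mult_right_mono mult_mono) (auto simp: k_def)
          finally show "ennreal (1 - (cmod a)\<^sup>2) * norm (?g t) \<le> ennreal K * ennreal (k t \<theta>)"
            using K a2 by (simp add: k_def ennreal_leI flip: ennreal_mult)
        qed
        also have "\<dots> = ennreal K * (\<integral>\<^sup>+t. ennreal (k t \<theta>) \<partial>\<nu>)"
          unfolding k_def by (intro nn_integral_cmult) measurable
        finally have "(ennreal (cmod (F (disc_aut a ?z) - F a)))\<^sup>2 \<le> (ennreal K * (\<integral>\<^sup>+t. ennreal (k t \<theta>) \<partial>\<nu>))\<^sup>2"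
          by (rule power_mono) simp
        then show ?thesis
          by (simp add: ennreal_power power_mult_distrib)
      qed
      have "(\<integral>\<^sup>+\<theta>\<in>{0..2*pi}. ennreal ((cmod (F (disc_aut a (of_real r * cis \<theta>)) - F a))\<^sup>2) \<partial>lborel)
          = (\<integral>\<^sup>+\<theta>. ennreal ((cmod (F (disc_aut a (of_real r * cis \<theta>)) - F a))\<^sup>2) \<partial>?N)"
        by (simp add: nn_integral_restrict_space)
      also have "\<dots> \<le> (\<integral>\<^sup>+\<theta>. (ennreal K)\<^sup>2 * (\<integral>\<^sup>+t. ennreal (k t \<theta>) \<partial>\<nu>)\<^sup>2 \<partial>?N)"
        by (intro nn_integral_mono ptw)
      also have "\<dots> = (ennreal K)\<^sup>2 * (\<integral>\<^sup>+\<theta>. (\<integral>\<^sup>+t. ennreal (k t \<theta>) \<partial>\<nu>)\<^sup>2 \<partial>?N)"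
        unfolding k_def by (intro nn_integral_cmult) measurable
      also have "\<dots> \<le> (ennreal K)\<^sup>2 * (ennreal (sqrt (2 * pi) * (32 * sqrt 2 * pi * C)))\<^sup>2"
        by (intro mult_left_mono order_trans[OF mink] power_mono w_int) auto
      also have "\<dots> = ennreal (2 * pi * (32 * sqrt 2 * pi * C * K)\<^sup>2)"
        using K C by (simp add: ennreal_power power_mult_distrib mult_ac flip: ennreal_mult)
      finally have "ennreal (1 / (2 * pi)) * (\<integral>\<^sup>+\<theta>\<in>{0..2*pi}. ennreal ((cmod (F (disc_aut a (of_real r * cis \<theta>)) - F a))\<^sup>2) \<partial>lborel)
          \<le> ennreal (1 / (2 * pi)) * ennreal (2 * pi * (32 * sqrt 2 * pi * C * K)\<^sup>2)"
        by (rule mult_left_mono) simp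
      also have "\<dots> = ennreal ((32 * sqrt 2 * pi * C * K)\<^sup>2)"
        by (subst ennreal_mult[symmetric]) auto
      finally have "ennsqrt (ennreal (1 / (2 * pi)) * (\<integral>\<^sup>+\<theta>\<in>{0..2*pi}. ennreal ((cmod (F (disc_aut a (of_real r * cis \<theta>)) - F a))\<^sup>2) \<partial>lborel))
          \<le> ennsqrt (ennreal ((32 * sqrt 2 * pi * C * K)\<^sup>2))"
        by (rule ennsqrt_mono)
      also have "\<dots> = ennreal (32 * sqrt 2 * pi * C * K)"
        using C K by (simp add: ennsqrt_ennreal)
      finally show "ennsqrt (ennreal (1 / (2 * pi)) * (\<integral>\<^sup>+\<theta>\<in>{0..2*pi}. ennreal ((cmod (F (disc_aut a (of_real r * cis \<theta>)) - F a))\<^sup>2) \<partial>lborel))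
          \<le> ennreal (32 * sqrt 2 * pi * C * K)" .
    qed
  qed
  have "BMOA_norm F \<le> ennreal (C * K) + ennreal (32 * sqrt 2 * pi * C * K)"
    unfolding BMOA_norm_def by (intro add_mono F0 SUP_least H2)
  also have "\<dots> = ennreal ((1 + 32 * sqrt 2 * pi) * C * K)"
    using C K by (simp add: algebra_simps flip: ennreal_plus)
  finally show "BMOA_norm F \<le> ennreal ((1 + 32 * sqrt 2 * pi) * C * K)" .
qed

text \<open>Dividing \<open>f\<close> by its logarithmic growth turns \<open>I_op \<mu> f\<close> into the Cauchy transform of a bounded function
  times the Carleson measure.\<close>

lemma carleson_imp_bounded:
  assumes \<mu>: "borel_measure_01 \<mu>" and carl: "carleson_measure (density \<mu> (\<lambda>t. ennreal (ln (2 / (1 - t)))))"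
    and s: "s > 0"
  shows "bounded_operator (Q_space s) (Q_norm s) BMOA BMOA_norm (I_op \<mu>)"
proof -
  define L :: "real \<Rightarrow> real" where "L t = ln (2 / (1 - t))" for t
  define \<nu> where "\<nu> = density \<mu> (\<lambda>t. ennreal (L t))"
  note space[simp] = space_borel_measure_01[OF \<mu>]
  have L[measurable]: "L \<in> borel_measurable \<mu>"
    unfolding L_def by (rule borel_measurable_borel_measure_01[OF \<mu>]) measurable
  have L0: "L t > 0" if "0 \<le> t" "t < 1" for t
    using that by (simp add: L_def)
  from carl obtain C where \<nu>: "borel_measure_01 \<nu>" and C: "C > 0"
    and carl: "\<And>t. 0 \<le> t \<Longrightarrow> t < 1 \<Longrightarrow> emeasure \<nu> {t..<1} \<le> ennreal (C * (1 - t))"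
    unfolding carleson_measure_def \<nu>_def L_def by auto
  define k where "k = 1 / ln 2 + 3 / ln 2 powr (s / 2)"
  have k: "k \<ge> 0" by (simp add: k_def)
  define M where "M = (1 + 32 * sqrt 2 * pi) * C * k"
  have M: "M \<ge> 0" using C k by (simp add: M_def)
  have *: "I_op \<mu> f \<in> BMOA \<and> BMOA_norm (I_op \<mu> f) \<le> ennreal M * Q_norm s f" if f: "f \<in> Q_space s" for f
  proof -
    define N where "N = enn2real (Q_norm s f)"
    note Q = Q_spaceD[OF f, folded N_def]
    define v where "v t = f (of_real t) / of_real (L t)" for t
    have "continuous_on {0..<1} (\<lambda>t. f (complex_of_real t))"
      by (intro continuous_on_compose2[OF holomorphic_on_imp_continuous_on[OF Q(1)]] continuous_intros) auto
    then have "(\<lambda>t. f (complex_of_real t)) \<in> borel_measurable (restrict_space borel {0..<1})"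
      by (rule borel_measurable_continuous_on_restrict)
    then have fm[measurable]: "(\<lambda>t. f (complex_of_real t)) \<in> borel_measurable \<mu>"
      using \<mu> unfolding borel_measure_01_def by (simp cong: measurable_cong_sets)
    note [measurable] = borel_measurable_of_real_borel_measure_01[OF \<mu>]
    have vm: "v \<in> borel_measurable \<nu>"
      unfolding v_def \<nu>_def by measurable
    have vb: "cmod (v t) \<le> k * N" if t: "0 \<le> t" "t < 1" for t
      using Q_space_growth[OF f s t] L0[OF t]
      by (simp add: v_def norm_divide divide_le_eq k_def N_def L_def)
    have eq: "I_op \<mu> f = (\<lambda>z. \<integral>t. v t / (1 - of_real t * z) \<partial>\<nu>)"
    proof
      fix z
      have "(\<integral>t. v t / (1 - of_real t * z) \<partial>\<nu>) = (\<integral>t. L t *\<^sub>R (v t / (1 - of_real t * z)) \<partial>\<mu>)"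
        unfolding \<nu>_def v_def using L0 by (intro integral_density) (auto intro!: AE_I2 less_imp_le)
      also have "\<dots> = I_op \<mu> f z"
        unfolding I_op_def
      proof (rule Bochner_Integration.integral_cong[OF refl])
        fix t assume "t \<in> space \<mu>"
        then have "L t \<noteq> 0" using L0[of t] by auto
        then show "L t *\<^sub>R (v t / (1 - of_real t * z)) = f (of_real t) / (1 - of_real t * z)"
          by (simp add: v_def scaleR_conv_of_real)
      qed
      finally show "I_op \<mu> f z = (\<integral>t. v t / (1 - of_real t * z) \<partial>\<nu>)" ..
    qed
    have kN: "k * N \<ge> 0" using k Q(3) by simp
    have "I_op \<mu> f holomorphic_on unit_disc" "BMOA_norm (I_op \<mu> f) \<le> ennreal ((1 + 32 * sqrt 2 * pi) * C * (k * N))"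
      unfolding eq by (rule carleson_cauchy_transform_BMOA[OF \<nu> less_imp_le[OF C] kN carl vm vb]; assumption)+
    moreover have "ennreal ((1 + 32 * sqrt 2 * pi) * C * (k * N)) = ennreal M * Q_norm s f"
      unfolding Q(2) using M Q(3) by (simp add: M_def mult.assoc flip: ennreal_mult)
    moreover have "ennreal M * Q_norm s f < \<infinity>"
      unfolding Q(2) by (simp add: ennreal_mult_less_top)
    ultimately show ?thesis
      by (auto simp: BMOA_def intro: le_less_trans)
  qed
  with M show ?thesis
    unfolding bounded_operator_def by blast
qed

section \<open>The logarithm lies in \<open>Q\<^sub>2\<close>\<close>

text \<open>This is \<open>u \<le> sinh u\<close> for \<open>u = ln x / 2\<close>, squared.\<close>

lemma ln_power2_le:
  assumes "x \<ge> (1::real)"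
  shows "(ln x)\<^sup>2 \<le> (x - 1)\<^sup>2 / x"
proof -
  have "ln x = 2 * ln (sqrt x)"
    using assms by (simp add: ln_sqrt)
  also have "\<dots> \<le> sqrt x - 1 / sqrt x"
    using assms real_le_x_sinh[of "ln (sqrt x)"] by (simp add: inverse_eq_divide)
  finally have "(ln x)\<^sup>2 \<le> (sqrt x - 1 / sqrt x)\<^sup>2"
    using assms by (intro power_mono) auto
  also have "sqrt x - 1 / sqrt x = (x - 1) / sqrt x"
    using assms by (simp add: diff_divide_distrib real_div_sqrt)
  also have "\<dots>\<^sup>2 = (x - 1)\<^sup>2 / x"
    using assms by (simp add: power_divide)
  finally show ?thesis .
qed

text \<open>With \<open>p = \<bar>z - a\<bar>\<close> and \<open>q = \<bar>1 - cnj a z\<bar>\<close> the Green function is \<open>ln (q / p)\<close>, and \<open>ln_power2_le\<close> bounds its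
  square by \<open>(q - p)\<^sup>2 / (p q)\<close>. This one expression covers both the logarithmic singularity at \<open>a\<close> and the
  decay at the boundary, where \<open>q\<^sup>2 - p\<^sup>2 = (1 - \<bar>a\<bar>\<^sup>2) (1 - \<bar>z\<bar>\<^sup>2)\<close> is small.\<close>

lemma green_power2_le:
  assumes a: "cmod a < 1" and z: "cmod z < 1" "z \<noteq> a"
  shows "(green z a)\<^sup>2 \<le> 128 * (1 - cmod a)\<^sup>2 * (1 - cmod z)\<^sup>2 / (cmod (z - a) * ((1 - cmod a) + cmod (z - a)) ^ 3)"
proof -
  define p q A Z where "p = cmod (z - a)" and "q = cmod (1 - cnj a * z)"
    and "A = 1 - cmod a" and "Z = 1 - cmod z"
  note low = one_minus_cnj_mult_lower[OF a z(1), folded p_def q_def A_def Z_def]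
  have p: "p > 0" using z(2) by (simp add: p_def)
  have A: "A > 0" and Z: "Z > 0" using a z by (auto simp: A_def Z_def)
  have "(green z a)\<^sup>2 = (ln (q / p))\<^sup>2"
    by (simp add: green_def norm_divide p_def q_def)
  also have "\<dots> \<le> (q / p - 1)\<^sup>2 / (q / p)"
    using p low(1) by (intro ln_power2_le) simp
  also have "\<dots> = (q - p)\<^sup>2 / (p * q)"
    using p low(1) by (simp add: field_simps power2_eq_square)
  also have "\<dots> \<le> (4 * A * Z / q)\<^sup>2 / (p * q)"
  proof (intro divide_right_mono power_mono)
    \<comment> \<open>\<open>q - p = (q\<^sup>2 - p\<^sup>2) / (q + p) \<le> (q\<^sup>2 - p\<^sup>2) / q\<close>\<close>
    have "(q - p) * q \<le> (q - p) * (q + p)"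
      using p low(1) by (intro mult_left_mono) auto
    also have "\<dots> = q\<^sup>2 - p\<^sup>2"
      by (simp add: power2_eq_square algebra_simps)
    also have "\<dots> = (1 - (cmod a)\<^sup>2) * (1 - (cmod z)\<^sup>2)"
      unfolding p_def q_def by (rule cmod_one_minus_cnj_mult)
    also have "\<dots> = (A * (1 + cmod a)) * (Z * (1 + cmod z))"
      by (simp add: A_def Z_def power2_eq_square algebra_simps)
    also have "\<dots> \<le> (A * 2) * (Z * 2)"
      using a z A Z by (intro mult_mono) auto
    finally show "q - p \<le> 4 * A * Z / q"
      using p low(1) by (simp add: field_simps)
  qed (use p low(1) in auto)
  also have "\<dots> = 16 * A\<^sup>2 * Z\<^sup>2 / (p * q ^ 3)"
    by (simp add: power_divide power_mult_distrib power2_eq_square power3_eq_cube mult_ac)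
  also have "\<dots> \<le> 16 * A\<^sup>2 * Z\<^sup>2 / (p * ((A + p) / 2) ^ 3)"
    using p low A by (intro divide_left_mono mult_left_mono power_mono mult_pos_pos zero_less_power mult_nonneg_nonneg) auto
  also have "\<dots> = 128 * A\<^sup>2 * Z\<^sup>2 / (p * (A + p) ^ 3)"
    by (simp add: power_divide)
  finally show ?thesis
    by (simp add: p_def A_def Z_def)
qed

text \<open>The integrand is comparable to \<open>r m (2 r)\<close> for \<open>r = \<bar>z - a\<bar>\<close> and \<open>m h = 1 / (h\<^sup>2 (d + h)\<^sup>3)\<close>; the disc of
  radius \<open>h\<close> has area \<open>pi h\<^sup>2\<close>, which cancels the singularity of \<open>m\<close>.\<close>

lemma nn_integral_radial_bound:
  fixes a :: complex
  assumes d: "d > 0"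
  shows "(\<integral>\<^sup>+z. ennreal (d\<^sup>2 / (cmod (z - a) * (d + cmod (z - a)) ^ 3)) \<partial>lborel) \<le> ennreal (16 * pi)"
proof -
  define m where "m h = 1 / (h\<^sup>2 * (d + h) ^ 3)" for h :: real
  have "(\<integral>\<^sup>+z. ennreal (d\<^sup>2 / (cmod (z - a) * (d + cmod (z - a)) ^ 3)) \<partial>lborel)
      \<le> (\<integral>\<^sup>+z. ennreal (32 * d\<^sup>2) * ennreal (cmod (z - a) * m (2 * cmod (z - a))) \<partial>lborel)"
  proof (rule nn_integral_mono)
    fix z
    have "d\<^sup>2 / (q * (d + q) ^ 3) \<le> 32 * d\<^sup>2 * (q * m (2 * q))" if q: "q \<ge> 0" for q
    proof (cases "q = 0")
      case False
      with q have q: "q > 0" by simp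
      have "d\<^sup>2 / (q * (d + q) ^ 3) = 32 * d\<^sup>2 / (4 * q * (2 * (d + q)) ^ 3)"
        by (simp only: power_mult_distrib) simp
      also have "\<dots> \<le> 32 * d\<^sup>2 / (4 * q * (d + 2 * q) ^ 3)"
        using q d by (intro divide_left_mono mult_left_mono power_mono mult_pos_pos zero_less_power) auto
      also have "\<dots> = 32 * d\<^sup>2 * (q * m (2 * q))"
        using q by (simp add: m_def power2_eq_square)
      finally show ?thesis .
    qed simp
    from this[of "cmod (z - a)"]
    have "ennreal (d\<^sup>2 / (cmod (z - a) * (d + cmod (z - a)) ^ 3)) \<le> ennreal (32 * d\<^sup>2 * (cmod (z - a) * m (2 * cmod (z - a))))"
      by (intro ennreal_leI) simp
    also have "\<dots> = ennreal (32 * d\<^sup>2) * ennreal (cmod (z - a) * m (2 * cmod (z - a)))"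
      by (rule ennreal_mult) (use d in \<open>auto simp: m_def\<close>)
    finally show "ennreal (d\<^sup>2 / (cmod (z - a) * (d + cmod (z - a)) ^ 3)) \<le> ennreal (32 * d\<^sup>2) * ennreal (cmod (z - a) * m (2 * cmod (z - a)))" .
  qed
  also have "\<dots> = ennreal (32 * d\<^sup>2) * (\<integral>\<^sup>+z. ennreal (cmod (z - a) * m (2 * cmod (z - a))) \<partial>lborel)"
    unfolding m_def by (intro nn_integral_cmult) measurable
  also have "\<dots> \<le> ennreal (32 * d\<^sup>2) * (\<integral>\<^sup>+h. ennreal (m h) * indicator {0..} h * emeasure lborel {z \<in> space lborel. cmod (z - a) < h} \<partial>lborel)"
  proof (intro mult_left_mono nn_integral_le_layer_cake)
    show "m k \<le> m h" if "0 < h" "h \<le> k" for h k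
      unfolding m_def using that d
      by (intro divide_left_mono mult_mono mult_pos_pos power_mono zero_less_power) auto
    show "m \<in> borel_measurable borel"
      unfolding m_def by measurable
  qed (auto simp: lborel.sigma_finite_measure_axioms)
  also have "\<dots> \<le> ennreal (32 * d\<^sup>2) * (\<integral>\<^sup>+h. ennreal (pi / (d + h) ^ 3) * indicator {0..} h \<partial>lborel)"
  proof (intro mult_left_mono nn_integral_mono)
    fix h :: real
    have "ennreal (m h) * emeasure lborel {z \<in> space lborel. cmod (z - a) < h} = ennreal (pi / (d + h) ^ 3)" if h: "h > 0"
    proof -
      have "{z \<in> space lborel. cmod (z - a) < h} = ball a h"
        by (auto simp: dist_norm norm_minus_commute)
      then have "emeasure lborel {z \<in> space lborel. cmod (z - a) < h} = ennreal (pi * h\<^sup>2)"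
        using h by (simp add: emeasure_ball unit_ball_vol_2)
      then have "ennreal (m h) * emeasure lborel {z \<in> space lborel. cmod (z - a) < h} = ennreal (m h * (pi * h\<^sup>2))"
        using h d by (simp add: m_def flip: ennreal_mult)
      also have "m h * (pi * h\<^sup>2) = pi / (d + h) ^ 3"
        using h by (simp add: m_def)
      finally show ?thesis .
    qed
    then show "ennreal (m h) * indicator {0..} h * emeasure lborel {z \<in> space lborel. cmod (z - a) < h}
        \<le> ennreal (pi / (d + h) ^ 3) * indicator {0..} h"
      by (cases "h > 0"; cases "h = 0") (auto simp: m_def)
  qed simp
  also have "(\<integral>\<^sup>+h. ennreal (pi / (d + h) ^ 3) * indicator {0..} h \<partial>lborel) = ennreal (0 - (- (pi / 2) / (d + 0)\<^sup>2))"
  proof (rule nn_integral_FTC_atLeast)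
    show "((\<lambda>h. - (pi / 2) / (d + h)\<^sup>2) has_real_derivative pi / (d + h) ^ 3) (at h)" if "0 \<le> h" for h
    proof -
      have pos: "d + h > 0" using that d by simp
      have "((\<lambda>h. - (pi / 2) * inverse ((d + h)\<^sup>2)) has_real_derivative
          - (pi / 2) * (- (inverse ((d + h)\<^sup>2) * (2 * (d + h)) * inverse ((d + h)\<^sup>2)))) (at h)"
        using pos by (auto intro!: derivative_eq_intros)
      moreover have "- (pi / 2) * (- (inverse (x\<^sup>2) * (2 * x) * inverse (x\<^sup>2))) = pi / x ^ 3" if "x > 0" for x :: real
        using that by (simp add: field_simps power2_eq_square power3_eq_cube)
      note this[OF pos]
      ultimately have "((\<lambda>h. - (pi / 2) * inverse ((d + h)\<^sup>2)) has_real_derivative pi / (d + h) ^ 3) (at h)"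
        by (simp only:)
      then show ?thesis
        by (simp only: divide_inverse[of _ "(d + _)\<^sup>2"])
    qed
    have "filterlim (\<lambda>h. (d + h)\<^sup>2) at_top at_top"
      by (intro filterlim_pow_at_top filterlim_tendsto_add_at_top[OF tendsto_const filterlim_ident]) simp
    then show "((\<lambda>h. - (pi / 2) / (d + h)\<^sup>2) \<longlongrightarrow> 0) at_top"
      by (intro tendsto_divide_0[OF tendsto_const] filterlim_at_top_imp_at_infinity)
  qed (use d in auto)
  also have "ennreal (32 * d\<^sup>2) * \<dots> = ennreal (32 * d\<^sup>2 * (0 - (- (pi / 2) / (d + 0)\<^sup>2)))"
    by (rule ennreal_mult[symmetric]) auto
  also have "32 * d\<^sup>2 * (0 - (- (pi / 2) / (d + 0)\<^sup>2)) = 16 * pi"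
    using d by simp
  finally show ?thesis .
qed

text \<open>This is \<open>ln (2 / (1 - z))\<close>, written as a difference so that the principal branch is visibly holomorphic
  on the disc.\<close>

definition log_fun :: "complex \<Rightarrow> complex" where
  "log_fun z = of_real (ln 2) - Ln (1 - z)"

lemma log_fun_has_derivative:
  assumes "cmod z < 1"
  shows "(log_fun has_field_derivative 1 / (1 - z)) (at z)"
proof -
  have "Re z < 1"
    using assms complex_Re_le_cmod[of z] by linarith
  then have "1 - z \<notin> \<real>\<^sub>\<le>\<^sub>0"
    by (auto simp: complex_nonpos_Reals_iff)
  then show ?thesis
    unfolding log_fun_def by (auto intro!: derivative_eq_intros simp: divide_inverse)
qed

lemma log_fun_of_real:
  assumes "t < 1"
  shows "log_fun (of_real t) = of_real (ln (2 / (1 - t)))"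
proof -
  have "1 - complex_of_real t = of_real (1 - t)"
    by simp
  then have "Ln (1 - of_real t) = of_real (ln (1 - t))"
    using assms Ln_of_real[of "1 - t"] by simp
  with assms show ?thesis
    by (simp add: log_fun_def ln_div)
qed

text \<open>The derivative has modulus at most \<open>1 / (1 - \<bar>z\<bar>)\<close>, and the square of this bound cancels the factor
  \<open>(1 - \<bar>z\<bar>)\<^sup>2\<close> in \<open>green_power2_le\<close>. What remains is the integrand of \<open>nn_integral_radial_bound\<close> with
  \<open>d = 1 - \<bar>a\<bar>\<close>.\<close>

lemma log_fun_in_Q_space: "log_fun \<in> Q_space 2"
proof -
  have hol: "log_fun holomorphic_on unit_disc"
    unfolding holomorphic_on_open[OF open_ball] by (metis log_fun_has_derivative mem_ball_0)
  have der: "deriv log_fun z = 1 / (1 - z)" if "cmod z < 1" for z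
    by (rule DERIV_imp_deriv log_fun_has_derivative that)+
  have "(\<integral>\<^sup>+z. ennreal ((cmod (deriv log_fun z))\<^sup>2 * green z a powr 2) \<partial>disc_area) \<le> ennreal 2048"
    if "a \<in> unit_disc" for a
  proof -
    from that have a: "cmod a < 1" by simp
    let ?k = "\<lambda>z. (1 - cmod a)\<^sup>2 / (cmod (z - a) * ((1 - cmod a) + cmod (z - a)) ^ 3)"
    have "(\<integral>\<^sup>+z. ennreal ((cmod (deriv log_fun z))\<^sup>2 * green z a powr 2) \<partial>disc_area)
        = ennreal (1 / pi) * (\<integral>\<^sup>+z\<in>unit_disc. ennreal ((cmod (deriv log_fun z))\<^sup>2 * green z a powr 2) \<partial>lborel)"
      by (rule nn_integral_disc_area[OF borel_measurable_Q_integrand[OF hol]])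
    also have "\<dots> \<le> ennreal (1 / pi) * (\<integral>\<^sup>+z. ennreal 128 * ennreal (?k z) \<partial>lborel)"
    proof (intro mult_left_mono nn_integral_mono)
      fix z
      show "ennreal ((cmod (deriv log_fun z))\<^sup>2 * green z a powr 2) * indicator unit_disc z \<le> ennreal 128 * ennreal (?k z)"
      proof (cases "cmod z < 1 \<and> z \<noteq> a")
        case True
        then have z: "cmod z < 1" "z \<noteq> a" by auto
        have "1 < cmod (1 - cnj a * z) / cmod (z - a)"
          using one_minus_cnj_mult_lower(1)[OF a z(1)] z by simp
        then have "0 \<le> green z a"
          by (simp add: green_def norm_divide)
        then have "green z a powr 2 = (green z a)\<^sup>2"
          by simp
        also have "\<dots> \<le> 128 * (1 - cmod a)\<^sup>2 * (1 - cmod z)\<^sup>2 / (cmod (z - a) * ((1 - cmod a) + cmod (z - a)) ^ 3)"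
          by (rule green_power2_le[OF a z])
        also have "\<dots> = (1 - cmod z)\<^sup>2 * (128 * ?k z)"
          by simp
        finally have g: "green z a powr 2 \<le> (1 - cmod z)\<^sup>2 * (128 * ?k z)" .
        have "1 - cmod z \<le> cmod (1 - z)"
          using norm_triangle_ineq2[of 1 z] by simp
        then have "cmod (deriv log_fun z) \<le> 1 / (1 - cmod z)"
          using z by (simp add: der norm_divide frac_le)
        then have "(cmod (deriv log_fun z))\<^sup>2 \<le> (1 / (1 - cmod z))\<^sup>2"
          by (rule power_mono) simp
        with g have "(cmod (deriv log_fun z))\<^sup>2 * green z a powr 2 \<le> (1 / (1 - cmod z))\<^sup>2 * ((1 - cmod z)\<^sup>2 * (128 * ?k z))"
          by (intro mult_mono) auto
        also have "\<dots> = 128 * ?k z"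
          using z by (simp add: power_divide)
        finally have "ennreal ((cmod (deriv log_fun z))\<^sup>2 * green z a powr 2) \<le> ennreal (128 * ?k z)"
          by (rule ennreal_leI)
        also have "\<dots> = ennreal 128 * ennreal (?k z)"
          using a by (intro ennreal_mult) auto
        finally show ?thesis using z by simp
      next
        case False
        then show ?thesis by (auto simp: green_def)
      qed
    qed simp
    also have "(\<integral>\<^sup>+z. ennreal 128 * ennreal (?k z) \<partial>lborel) = ennreal 128 * (\<integral>\<^sup>+z. ennreal (?k z) \<partial>lborel)"
      by (intro nn_integral_cmult) measurable
    also have "ennreal (1 / pi) * \<dots> \<le> ennreal (1 / pi) * (ennreal 128 * ennreal (16 * pi))"
      using a by (intro mult_left_mono nn_integral_radial_bound) auto
    also have "\<dots> = ennreal (1 / pi * (128 * (16 * pi)))"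
      by (subst (1 2) ennreal_mult) auto
    also have "1 / pi * (128 * (16 * pi)) = 2048"
      by simp
    finally show ?thesis .
  qed
  then have "(SUP a\<in>unit_disc. \<integral>\<^sup>+z. ennreal ((cmod (deriv log_fun z))\<^sup>2 * green z a powr 2) \<partial>disc_area) \<le> ennreal 2048"
    by (rule SUP_least)
  then have "(Q_seminorm 2 log_fun)\<^sup>2 \<le> ennreal 2048"
    unfolding Q_seminorm_def power2_ennsqrt .
  then have "(Q_norm 2 log_fun)\<^sup>2 < \<infinity>"
    unfolding Q_norm_def power2_ennsqrt by (auto simp: ennreal_add_less_top intro: le_less_trans)
  then have "Q_norm 2 log_fun < \<infinity>"
    by (cases "Q_norm 2 log_fun") (auto simp: power2_eq_square)
  with hol show ?thesis
    by (simp add: Q_space_def)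
qed

section \<open>A Cauchy transform in BMOA comes from a Carleson measure\<close>

text \<open>For \<open>a = \<alpha> \<ge> 1/2\<close> let \<open>F\<close> be the Cauchy transform and write \<open>F (disc_aut a z) - F a\<close> as
  \<open>- z (1 - \<alpha>\<^sup>2) H z\<close>. Then \<open>H 0\<close> is an integral of nonnegative numbers, it is at most a multiple of the
  BMOA norm divided by \<open>1 - \<alpha>\<^sup>2\<close>, and its integrand is at least \<open>L t \<alpha> / (1 - \<alpha>\<^sup>2)\<^sup>2\<close> on \<open>[\<alpha>, 1)\<close>.
  For \<open>\<alpha> < 1/2\<close> the finite total mass suffices.\<close>

lemma BMOA_imp_carleson:
  assumes \<mu>: "borel_measure_01 \<mu>" and L: "integrable \<mu> L" "\<And>t. 0 \<le> t \<Longrightarrow> t < 1 \<Longrightarrow> 0 \<le> L t"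
    and fin: "BMOA_norm (\<lambda>z. \<integral>t. of_real (L t) / (1 - of_real t * z) \<partial>\<mu>) < \<infinity>"
  shows "\<exists>C>0. \<forall>t\<in>{0..<1}. emeasure (density \<mu> L) {t..<1} \<le> ennreal (C * (1 - t))"
proof -
  define F :: "complex \<Rightarrow> complex" where "F z = (\<integral>t. of_real (L t) / (1 - of_real t * z) \<partial>\<mu>)" for z
  note space[simp] = space_borel_measure_01[OF \<mu>]
  have [measurable]: "L \<in> borel_measurable \<mu>" using L(1) by auto
  have sets[measurable]: "{t..<1} \<in> sets \<mu>" if "0 \<le> t" for t
    using \<mu> that by (auto simp: borel_measure_01_def sets_restrict_space_iff)
  have em: "emeasure (density \<mu> L) {t..<1} = (\<integral>\<^sup>+x. ennreal (L x) * indicator {t..<1} x \<partial>\<mu>)" if "0 \<le> t" for t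
    using sets[OF that] by (intro emeasure_density) auto
  have u: "integrable \<mu> (\<lambda>t. complex_of_real (L t))"
    using L(1) by simp
  define A where "A = (\<integral>t. L t \<partial>\<mu>)"
  have A: "A \<ge> 0" unfolding A_def using L(2) by (intro integral_nonneg_AE AE_I2) auto
  have mass: "emeasure (density \<mu> L) {t..<1} \<le> ennreal A" if "0 \<le> t" for t
  proof -
    have "emeasure (density \<mu> L) {t..<1} \<le> (\<integral>\<^sup>+x. ennreal (L x) \<partial>\<mu>)"
      unfolding em[OF that] by (intro nn_integral_mono) (auto split: split_indicator)
    also have "\<dots> = ennreal A"
      unfolding A_def using L by (intro nn_integral_eq_integral) (auto intro!: AE_I2)
    finally show ?thesis .
  qed
  define B where "B = enn2real (BMOA_norm F)"
  have B: "BMOA_norm F = ennreal B" "B \<ge> 0"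
    using fin by (auto simp: B_def F_def[abs_def])
  have main: "emeasure (density \<mu> L) {\<alpha>..<1} \<le> ennreal (8 * B * (1 - \<alpha>))" if \<alpha>: "1/2 \<le> \<alpha>" "\<alpha> < 1" for \<alpha> :: real
  proof -
    define a where "a = complex_of_real \<alpha>"
    have a: "cmod a < 1" using \<alpha> by (simp add: a_def)
    define w where "w t = L t * t / (1 - t * \<alpha>)\<^sup>2" for t
    have wc: "complex_of_real (L t) * of_real t / (1 - of_real t * a)\<^sup>2 = of_real (w t)" for t
      by (simp add: w_def a_def)
    define H where "H z = (\<integral>t. of_real (w t) / (1 - mobius_coeff a t * z) \<partial>\<mu>)" for z
    note tr = cauchy_transform_disc_aut[OF \<mu> u a, unfolded wc]
    have wi: "integrable \<mu> w"
      using tr(1)[of 0] by (simp add: complex_of_real_integrable_eq)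
    have H: "H holomorphic_on unit_disc"
      unfolding H_def
      by (rule holomorphic_on_cauchy_transform)
         (use tr(1,2)[of 0] cmod_mobius_coeff_less_1[OF a] in \<open>auto intro: less_imp_le\<close>)
    have w0: "0 \<le> w t" if "0 \<le> t" "t < 1" for t
      using that L(2) by (simp add: w_def)
    have H0: "H 0 = of_real (\<integral>t. w t \<partial>\<mu>)"
      unfolding H_def by simp
    have W: "0 \<le> (\<integral>t. w t \<partial>\<mu>)"
      using w0 by (intro integral_nonneg_AE AE_I2) auto
    \<comment> \<open>The circle of radius \<open>1/2\<close> suffices: \<open>\<bar>H 0\<bar>\<^sup>2\<close> is at most the mean of \<open>\<bar>H\<bar>\<^sup>2\<close> there, and the factor \<open>z\<close> has
    modulus \<open>1/2\<close>, which accounts for the denominator \<open>2\<close>.\<close>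
    have "ennreal ((1 - \<alpha>\<^sup>2) / 2 * (\<integral>t. w t \<partial>\<mu>)) \<le> ennreal B"
    proof -
      let ?c = "(1 - \<alpha>\<^sup>2) / 2"
      have c: "?c \<ge> 0" using \<alpha> by (simp add: power_le_one)
      let ?I = "\<lambda>G. \<integral>\<^sup>+\<theta>\<in>{0..2*pi}. ennreal ((cmod (G (of_real (1/2) * cis \<theta>)))\<^sup>2) \<partial>lborel"
      have "ennreal (?c\<^sup>2) * ennreal (2 * pi * (cmod (H 0))\<^sup>2) \<le> ennreal (?c\<^sup>2) * ?I H"
        using circle_square_mean[OF H, of "of_real (1/2)"] by (intro mult_left_mono) auto
      also have "\<dots> = (\<integral>\<^sup>+\<theta>. ennreal (?c\<^sup>2) * (ennreal ((cmod (H (of_real (1/2) * cis \<theta>)))\<^sup>2) * indicator {0..2*pi} \<theta>) \<partial>lborel)"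
      proof (rule nn_integral_cmult[symmetric])
        have "continuous_on UNIV (\<lambda>\<theta>. H (of_real (1/2) * cis \<theta>))"
          by (intro continuous_on_compose2[OF holomorphic_on_imp_continuous_on[OF H]] continuous_intros)
             (auto simp: norm_mult)
        then have [measurable]: "(\<lambda>\<theta>. H (of_real (1/2) * cis \<theta>)) \<in> borel_measurable borel"
          by (rule borel_measurable_continuous_onI)
        show "(\<lambda>\<theta>. ennreal ((cmod (H (of_real (1/2) * cis \<theta>)))\<^sup>2) * indicator {0..2*pi} \<theta>) \<in> borel_measurable lborel"
          by measurable
      qed
      also have "\<dots> = ?I (\<lambda>z. F (disc_aut a z) - F a)"
      proof (rule nn_integral_cong)
        fix \<theta> :: real
        let ?z = "of_real (1/2) * cis \<theta>"
        have z: "cmod ?z = 1/2" by (simp add: norm_mult)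
        have "F (disc_aut a ?z) - F a = - ?z * of_real (1 - (cmod a)\<^sup>2) * H ?z"
          unfolding F_def H_def by (rule tr(4)) (subst z, simp)
        then have "cmod (F (disc_aut a ?z) - F a) = ?c * cmod (H ?z)"
          using \<alpha> c by (simp only: norm_mult norm_minus_cancel norm_of_real z) (simp add: a_def)
        then show "ennreal (?c\<^sup>2) * (ennreal ((cmod (H ?z))\<^sup>2) * indicator {0..2*pi} \<theta>)
            = ennreal ((cmod (F (disc_aut a ?z) - F a))\<^sup>2) * indicator {0..2*pi} \<theta>"
          by (simp only: power_mult_distrib ennreal_mult' zero_le_power2 mult.assoc)
      qed
      finally have 1: "ennreal (?c\<^sup>2) * ennreal (2 * pi * (cmod (H 0))\<^sup>2) \<le> ?I (\<lambda>z. F (disc_aut a z) - F a)" .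
      have "ennreal ((?c * cmod (H 0))\<^sup>2) = ennreal (1 / (2 * pi)) * (ennreal (?c\<^sup>2) * ennreal (2 * pi * (cmod (H 0))\<^sup>2))"
        by (simp add: power_mult_distrib power_divide flip: ennreal_mult)
      also have "\<dots> \<le> ennreal (1 / (2 * pi)) * ?I (\<lambda>z. F (disc_aut a z) - F a)"
        by (intro mult_left_mono 1) simp
      finally have "ennsqrt (ennreal ((?c * cmod (H 0))\<^sup>2)) \<le> ennsqrt (ennreal (1 / (2 * pi)) * ?I (\<lambda>z. F (disc_aut a z) - F a))"
        by (rule ennsqrt_mono)
      also have "\<dots> \<le> H2_norm (\<lambda>z. F (disc_aut a z) - F a)"
        unfolding H2_norm_def by (rule SUP_upper2[of "1/2"]) auto
      also have "\<dots> \<le> (SUP a\<in>unit_disc. H2_norm (\<lambda>z. F (disc_aut a z) - F a))"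
        by (rule SUP_upper) (use a in auto)
      also have "\<dots> \<le> BMOA_norm F"
        unfolding BMOA_norm_def by simp
      finally have "ennsqrt (ennreal ((?c * cmod (H 0))\<^sup>2)) \<le> ennreal B"
        by (simp add: B(1))
      moreover have "ennsqrt (ennreal ((?c * cmod (H 0))\<^sup>2)) = ennreal (?c * cmod (H 0))"
        using c by (subst ennsqrt_ennreal) (auto simp: abs_mult)
      ultimately show ?thesis
        using W by (simp add: H0)
    qed
    then have "(1 - \<alpha>\<^sup>2) / 2 * (\<integral>t. w t \<partial>\<mu>) \<le> B"
      using B(2) by (simp add: ennreal_le_iff)
    then have wB: "(\<integral>t. w t \<partial>\<mu>) \<le> 2 * B / (1 - \<alpha>\<^sup>2)"
      using \<alpha> by (simp add: field_simps power_less_one_iff)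
    have pos: "1 - \<alpha>\<^sup>2 > 0" using \<alpha> by (simp add: power_less_one_iff)
    have "emeasure (density \<mu> L) {\<alpha>..<1} \<le> (\<integral>\<^sup>+t. ennreal ((1 - \<alpha>\<^sup>2)\<^sup>2 / \<alpha>) * ennreal (w t) \<partial>\<mu>)"
      unfolding em[OF order_trans[OF _ \<alpha>(1), of 0, simplified]]
    proof (rule nn_integral_mono)
      fix t assume "t \<in> space \<mu>"
      then have t: "0 \<le> t" "t < 1" by auto
      show "ennreal (L t) * indicator {\<alpha>..<1} t \<le> ennreal ((1 - \<alpha>\<^sup>2)\<^sup>2 / \<alpha>) * ennreal (w t)"
      proof (cases "\<alpha> \<le> t")
        case True
        have "t * \<alpha> \<le> 1 * \<alpha>" "\<alpha> * \<alpha> \<le> t * \<alpha>"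
          using \<alpha> t True by (auto intro!: mult_right_mono)
        then have t\<alpha>: "0 < 1 - t * \<alpha>" "1 - t * \<alpha> \<le> 1 - \<alpha>\<^sup>2"
          unfolding power2_eq_square using \<alpha>(2) by linarith+
        have "L t = (1 - t * \<alpha>)\<^sup>2 / \<alpha> * (L t * \<alpha> / (1 - t * \<alpha>)\<^sup>2)"
          using t\<alpha> \<alpha> by simp
        also have "\<dots> \<le> (1 - \<alpha>\<^sup>2)\<^sup>2 / \<alpha> * w t"
          unfolding w_def using t\<alpha> \<alpha> L(2)[OF t] True
          by (intro mult_mono divide_right_mono power_mono mult_left_mono) auto
        finally show ?thesis
          using True t w0[OF t] \<alpha> by (simp add: ennreal_leI flip: ennreal_mult)
      qed simp
    qed
    also have "\<dots> = ennreal ((1 - \<alpha>\<^sup>2)\<^sup>2 / \<alpha>) * (\<integral>\<^sup>+t. ennreal (w t) \<partial>\<mu>)"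
      using wi by (intro nn_integral_cmult) auto
    also have "(\<integral>\<^sup>+t. ennreal (w t) \<partial>\<mu>) = ennreal (\<integral>t. w t \<partial>\<mu>)"
      using w0 by (intro nn_integral_eq_integral wi AE_I2) auto
    also have "ennreal ((1 - \<alpha>\<^sup>2)\<^sup>2 / \<alpha>) * \<dots> = ennreal ((1 - \<alpha>\<^sup>2)\<^sup>2 / \<alpha> * (\<integral>t. w t \<partial>\<mu>))"
      using W \<alpha> by (intro ennreal_mult[symmetric]) auto
    also have "\<dots> \<le> ennreal (8 * B * (1 - \<alpha>))"
    proof (rule ennreal_leI)
      have "(1 - \<alpha>\<^sup>2)\<^sup>2 / \<alpha> * (\<integral>t. w t \<partial>\<mu>) \<le> (1 - \<alpha>\<^sup>2)\<^sup>2 / \<alpha> * (2 * B / (1 - \<alpha>\<^sup>2))"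
        using \<alpha> by (intro mult_left_mono wB) auto
      also have "\<dots> = (1 - \<alpha>\<^sup>2) * (2 * B) / \<alpha>"
        using pos by (simp add: power2_eq_square)
      also have "\<dots> \<le> (1 - \<alpha>\<^sup>2) * (2 * B) / (1/2)"
        using \<alpha> pos B(2) by (intro divide_left_mono) auto
      also have "\<dots> = 4 * B * (1 - \<alpha>\<^sup>2)"
        by simp
      also have "\<dots> \<le> 4 * B * (2 * (1 - \<alpha>))"
      proof (rule mult_left_mono)
        show "1 - \<alpha>\<^sup>2 \<le> 2 * (1 - \<alpha>)"
          using zero_le_power2[of "1 - \<alpha>"] by (simp add: power2_eq_square algebra_simps)
      qed (use B(2) in auto)
      also have "4 * B * (2 * (1 - \<alpha>)) = 8 * B * (1 - \<alpha>)"
        by simp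
      finally show "(1 - \<alpha>\<^sup>2)\<^sup>2 / \<alpha> * (\<integral>t. w t \<partial>\<mu>) \<le> 8 * B * (1 - \<alpha>)" .
    qed
    finally show ?thesis .
  qed
  have "emeasure (density \<mu> L) {t..<1} \<le> ennreal ((8 * B + 2 * A + 1) * (1 - t))" if t: "t \<in> {0..<1}" for t
  proof (cases "1/2 \<le> t")
    case True
    with t have "emeasure (density \<mu> L) {t..<1} \<le> ennreal (8 * B * (1 - t))"
      by (intro main) auto
    also have "\<dots> \<le> ennreal ((8 * B + 2 * A + 1) * (1 - t))"
      using t A by (intro ennreal_leI mult_right_mono) auto
    finally show ?thesis .
  next
    case False
    have "A * 1 \<le> A * (2 * (1 - t))"
      using False A by (intro mult_left_mono) auto
    also have "\<dots> = 2 * A * (1 - t)"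
      by simp
    also have "\<dots> \<le> (8 * B + 2 * A + 1) * (1 - t)"
      using t B by (intro mult_right_mono) auto
    finally have "ennreal A \<le> ennreal ((8 * B + 2 * A + 1) * (1 - t))"
      by (intro ennreal_leI) simp
    with mass[of t] t show ?thesis
      by (auto intro: order_trans)
  qed
  moreover have "8 * B + 2 * A + 1 > 0" using A B by simp
  ultimately show ?thesis by blast
qed

section \<open>The equivalence\<close>

theorem theorem3p2:
  fixes \<mu> :: "real measure"
  assumes "borel_measure_01 \<mu>"
    and "(\<integral>\<^sup>+ t. ennreal (ln (2 / (1 - t))) \<partial>\<mu>) < \<infinity>"
  shows "carleson_measure (density \<mu> (\<lambda>t. ennreal (ln (2 / (1 - t))))) \<longleftrightarrow>
         (\<forall>s::real. s > 0 \<longrightarrow>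
            bounded_operator (Q_space s) (Q_norm s) BMOA BMOA_norm (I_op \<mu>))"
proof (intro iffI allI impI)
  show "bounded_operator (Q_space s) (Q_norm s) BMOA BMOA_norm (I_op \<mu>)"
    if "carleson_measure (density \<mu> (\<lambda>t. ennreal (ln (2 / (1 - t)))))" "s > 0" for s
    using carleson_imp_bounded[OF assms(1)] that by blast
next
  assume "\<forall>s::real. s > 0 \<longrightarrow> bounded_operator (Q_space s) (Q_norm s) BMOA BMOA_norm (I_op \<mu>)"
  then have "bounded_operator (Q_space 2) (Q_norm 2) BMOA BMOA_norm (I_op \<mu>)"
    by simp
  then have fin: "BMOA_norm (I_op \<mu> log_fun) < \<infinity>"
    using log_fun_in_Q_space by (auto simp: bounded_operator_def BMOA_def)
  note space[simp] = space_borel_measure_01[OF assms(1)]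
  have nonneg: "0 \<le> ln (2 / (1 - t))" if "0 \<le> t" "t < 1" for t :: real
    using that by simp
  have int: "integrable \<mu> (\<lambda>t. ln (2 / (1 - t)))"
  proof (rule integrableI_nonneg)
    show "(\<lambda>t. ln (2 / (1 - t))) \<in> borel_measurable \<mu>"
      by (rule borel_measurable_borel_measure_01[OF assms(1)]) measurable
  qed (use assms(2) nonneg in \<open>auto intro!: AE_I2\<close>)
  have "I_op \<mu> log_fun = (\<lambda>z. \<integral>t. of_real (ln (2 / (1 - t))) / (1 - of_real t * z) \<partial>\<mu>)"
    unfolding I_op_def by (intro ext Bochner_Integration.integral_cong) (auto simp: log_fun_of_real)
  with fin have "BMOA_norm (\<lambda>z. \<integral>t. of_real (ln (2 / (1 - t))) / (1 - of_real t * z) \<partial>\<mu>) < \<infinity>"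
    by simp
  from BMOA_imp_carleson[OF assms(1) int nonneg this]
  show "carleson_measure (density \<mu> (\<lambda>t. ennreal (ln (2 / (1 - t)))))"
    using assms(1) by (simp add: carleson_measure_def borel_measure_01_def)
qed

end
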